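(* Let $H$ be a connected graph which is edge-transitive under its cut involution group $W_H$. If there exists a percolating sequence $J_0,J_1,\dots,J_N$ in $H$, then $H$ is weakly norming.
   Context: For a connected graph $H$, a cut involution is an automorphism $\phi$ with $\phi=\phi^{-1}$ whose fixed point set $F_\phi$ is a vertex cut. For each cut involution $\phi$, fix disjoint sets $L_\phi,R_\phi$ partitioning $V(H)\setminus F_\phi$, each a union of components of $H\setminus F_\phi$, with $\phi(L_\phi)=R_\phi$. Left-folding map: $\phi^+(v)=\phi(v)$ if $v\in R_\phi$, $\phi^+(v)=v$ otherwise; right-folding map $\phi^-$: swap roles of $L_\phi,R_\phi$. The cut involution group $W_H$ is the subgroup of $\mathrm{Aut}(H)$ generated by all cut involutions. For $J\subseteq E(H)$, $J^+(\phi)=\{uv\in E(H):\phi^+(u)\phi^+(v)\in J\}$ and $J^-(\phi)=\{uv\in E(H):\phi^-(u)\phi^-(v)\in J\}$. A folding sequence is a sequence $J_0,J_1,\dots$ of edge subsets such that for each $i$, $J_{i+1}=J_i^+(\phi)$ or $J_{i+1}=J_i^-(\phi)$ for some cut involution $\phi$. A percolating sequence is a finite folding sequence $J_0,\dots,J_N$ with $|J_0|=1$ and $J_N=E(H)$. With $\|f\|_{r(H)}:=\left(\int\prod_{ij\in E(H)}|f(x_i,x_j)|\,d\mu^{|V(H)|}\right)^{1/|E(H)|}$ ($\mu$ Lebesgue measure), $H$ is weakly norming if $\|\cdot\|_{r(H)}$ is a norm on bounded measurable functions $[0,1]^2\to\mathbb{R}$. *)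

theory Defs
  imports "HOL-Analysis.Analysis" "HOL-Algebra.Bij" "HOL-Algebra.Generated_Groups"
begin

section \<open>Graphs\<close>

text \<open>A graph is a vertex set \<open>V\<close> together with a set \<open>E\<close> of unordered pairs of vertices.\<close>

definition simple_graph :: "'a set \<Rightarrow> 'a set set \<Rightarrow> bool" where
  "simple_graph V E \<longleftrightarrow> finite V \<and> (\<forall>e\<in>E. e \<subseteq> V \<and> card e = 2)"

definition adj_within :: "'a set set \<Rightarrow> 'a set \<Rightarrow> ('a \<times> 'a) set" where
  "adj_within E U = {(u, v). u \<in> U \<and> v \<in> U \<and> {u, v} \<in> E}"

definition graph_components :: "'a set set \<Rightarrow> 'a set \<Rightarrow> 'a set set" where
  "graph_components E U = (\<lambda>u. {v. (u, v) \<in> (adj_within E U)\<^sup>*}) ` U"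

definition connected_graph :: "'a set \<Rightarrow> 'a set set \<Rightarrow> bool" where
  "connected_graph V E \<longleftrightarrow> V \<noteq> {} \<and> (\<forall>u\<in>V. \<forall>v\<in>V. (u, v) \<in> (adj_within E V)\<^sup>*)"

text \<open>Deleting a vertex cut leaves at least two components; in particular \<open>F = V\<close> is not a cut.\<close>

definition vertex_cut :: "'a set \<Rightarrow> 'a set set \<Rightarrow> 'a set \<Rightarrow> bool" where
  "vertex_cut V E F \<longleftrightarrow>
     F \<subseteq> V \<and> (\<exists>u\<in>V - F. \<exists>v\<in>V - F. (u, v) \<notin> (adj_within E (V - F))\<^sup>*)"

section \<open>Cut involutions\<close>

definition graph_auts :: "'a set \<Rightarrow> 'a set set \<Rightarrow> ('a \<Rightarrow> 'a) set" where
  "graph_auts V E = {\<phi> \<in> Bij V. \<forall>u\<in>V. \<forall>v\<in>V. {\<phi> u, \<phi> v} \<in> E \<longleftrightarrow> {u, v} \<in> E}"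

definition Aut_graph :: "'a set \<Rightarrow> 'a set set \<Rightarrow> ('a \<Rightarrow> 'a) monoid" where
  "Aut_graph V E = (BijGroup V)\<lparr>carrier := graph_auts V E\<rparr>"

definition fix_set :: "'a set \<Rightarrow> ('a \<Rightarrow> 'a) \<Rightarrow> 'a set" where
  "fix_set V \<phi> = {v \<in> V. \<phi> v = v}"

definition cut_involution :: "'a set \<Rightarrow> 'a set set \<Rightarrow> ('a \<Rightarrow> 'a) \<Rightarrow> bool" where
  "cut_involution V E \<phi> \<longleftrightarrow>
     \<phi> \<in> graph_auts V E \<and> (\<forall>v\<in>V. \<phi> (\<phi> v) = v) \<and> vertex_cut V E (fix_set V \<phi>)"

definition cut_involution_group :: "'a set \<Rightarrow> 'a set set \<Rightarrow> ('a \<Rightarrow> 'a) set" where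
  "cut_involution_group V E = generate (Aut_graph V E) {\<phi>. cut_involution V E \<phi>}"

definition edge_transitive_under :: "'a set set \<Rightarrow> ('a \<Rightarrow> 'a) set \<Rightarrow> bool" where
  "edge_transitive_under E W \<longleftrightarrow> (\<forall>e\<in>E. \<forall>e'\<in>E. \<exists>g\<in>W. g ` e = e')"

section \<open>Folding\<close>

definition fold_sides ::
    "'a set \<Rightarrow> 'a set set \<Rightarrow> ('a \<Rightarrow> 'a) \<Rightarrow> 'a set \<Rightarrow> 'a set \<Rightarrow> bool" where
  "fold_sides V E \<phi> L R \<longleftrightarrow>
     L \<inter> R = {} \<and> L \<union> R = V - fix_set V \<phi> \<and>
     (\<exists>\<C> \<subseteq> graph_components E (V - fix_set V \<phi>). L = \<Union>\<C>) \<and>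
     (\<exists>\<C> \<subseteq> graph_components E (V - fix_set V \<phi>). R = \<Union>\<C>) \<and>
     \<phi> ` L = R"

text \<open>
  A fixed choice of sides \<open>L \<phi>\<close>, \<open>R \<phi>\<close> for each cut involution \<open>\<phi>\<close>. Sides exist unless \<open>\<phi>\<close> maps some
  component of \<open>H - F\<close> to itself; an involution of that kind still counts as a generator of the
  cut involution group, but it has no folding maps and is not used in folding sequences.
\<close>

definition side_choice ::
    "'a set \<Rightarrow> 'a set set \<Rightarrow> (('a \<Rightarrow> 'a) \<Rightarrow> 'a set) \<Rightarrow> (('a \<Rightarrow> 'a) \<Rightarrow> 'a set) \<Rightarrow> bool" where
  "side_choice V E L R \<longleftrightarrow>
     (\<forall>\<phi>. cut_involution V E \<phi> \<and> (\<exists>X Y. fold_sides V E \<phi> X Y) \<longrightarrow> fold_sides V E \<phi> (L \<phi>) (R \<phi>))"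

text \<open>\<open>fold_map \<phi> (R \<phi>)\<close> is the left-folding map and \<open>fold_map \<phi> (L \<phi>)\<close> the right-folding map.\<close>

definition fold_map :: "('a \<Rightarrow> 'a) \<Rightarrow> 'a set \<Rightarrow> 'a \<Rightarrow> 'a" where
  "fold_map \<phi> S v = (if v \<in> S then \<phi> v else v)"

definition fold_pullback :: "'a set set \<Rightarrow> ('a \<Rightarrow> 'a) \<Rightarrow> 'a set set \<Rightarrow> 'a set set" where
  "fold_pullback E p J = {e \<in> E. p ` e \<in> J}"

definition folding_step ::
    "'a set \<Rightarrow> 'a set set \<Rightarrow> (('a \<Rightarrow> 'a) \<Rightarrow> 'a set) \<Rightarrow> (('a \<Rightarrow> 'a) \<Rightarrow> 'a set) \<Rightarrow>
     'a set set \<Rightarrow> 'a set set \<Rightarrow> bool" where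
  "folding_step V E L R J J' \<longleftrightarrow>
     (\<exists>\<phi>. cut_involution V E \<phi> \<and> fold_sides V E \<phi> (L \<phi>) (R \<phi>) \<and>
        (J' = fold_pullback E (fold_map \<phi> (R \<phi>)) J \<or>
         J' = fold_pullback E (fold_map \<phi> (L \<phi>)) J))"

definition percolating_sequence ::
    "'a set \<Rightarrow> 'a set set \<Rightarrow> (('a \<Rightarrow> 'a) \<Rightarrow> 'a set) \<Rightarrow> (('a \<Rightarrow> 'a) \<Rightarrow> 'a set) \<Rightarrow>
     (nat \<Rightarrow> 'a set set) \<Rightarrow> nat \<Rightarrow> bool" where
  "percolating_sequence V E L R J N \<longleftrightarrow>
     (\<forall>i\<le>N. J i \<subseteq> E) \<and> (\<forall>i<N. folding_step V E L R (J i) (J (Suc i))) \<and>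
     card (J 0) = 1 \<and> J N = E"

section \<open>Weakly norming graphs\<close>

text \<open>
  The functions are Lebesgue measurable on the unit square and not assumed symmetric, so the factor
  \<open>\<bar>f (x\<^sub>i, x\<^sub>j)\<bar>\<close> of an edge depends on the order of its ends. As usual, \<open>H\<close> is bipartite and every edge
  is read from \<open>A\<close> to \<open>B\<close> for a bipartition \<open>(A, B)\<close>. The completion makes the integrand measurable
  for every Lebesgue measurable \<open>f\<close>.
\<close>

definition bounded_measurable :: "(real \<times> real \<Rightarrow> real) set" where
  "bounded_measurable =
     {f \<in> borel_measurable (lebesgue_on ({0..1} \<times> {0..1})). bounded (f ` ({0..1} \<times> {0..1}))}"

definition cube_measure :: "'a set \<Rightarrow> ('a \<Rightarrow> real) measure" where
  "cube_measure V = completion (\<Pi>\<^sub>M v\<in>V. restrict_space lborel {0..1})"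

definition bipartition :: "'a set \<Rightarrow> 'a set set \<Rightarrow> 'a set \<Rightarrow> 'a set \<Rightarrow> bool" where
  "bipartition V E A B \<longleftrightarrow>
     A \<inter> B = {} \<and> A \<union> B = V \<and> (\<forall>e\<in>E. \<exists>a\<in>A. \<exists>b\<in>B. e = {a, b})"

definition r_norm ::
    "'a set \<Rightarrow> 'a set set \<Rightarrow> 'a set \<Rightarrow> 'a set \<Rightarrow> (real \<times> real \<Rightarrow> real) \<Rightarrow> real" where
  "r_norm V E A B f =
     (LINT x|cube_measure V. (\<Prod>(a, b)\<in>{(a, b) \<in> A \<times> B. {a, b} \<in> E}. \<bar>f (x a, x b)\<bar>))
       powr (1 / real (card E))"

text \<open>Norm axioms on bounded measurable functions, identified when equal almost everywhere.\<close>

definition norm_on_bounded_measurable :: "((real \<times> real \<Rightarrow> real) \<Rightarrow> real) \<Rightarrow> bool" where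
  "norm_on_bounded_measurable \<N> \<longleftrightarrow>
     (\<forall>f\<in>bounded_measurable. 0 \<le> \<N> f) \<and>
     (\<forall>f\<in>bounded_measurable.
        \<N> f = 0 \<longleftrightarrow> (AE z in lebesgue_on ({0..1} \<times> {0..1}). f z = 0)) \<and>
     (\<forall>c. \<forall>f\<in>bounded_measurable. \<N> (\<lambda>z. c * f z) = \<bar>c\<bar> * \<N> f) \<and>
     (\<forall>f\<in>bounded_measurable. \<forall>g\<in>bounded_measurable. \<N> (\<lambda>z. f z + g z) \<le> \<N> f + \<N> g)"

text \<open>
  For connected \<open>H\<close> the bipartition is unique up to interchanging \<open>A\<close> and \<open>B\<close>, which amounts to
  transposing \<open>f\<close>; the first conjunct prevents the second from holding vacuously.
\<close>

definition weakly_norming :: "'a set \<Rightarrow> 'a set set \<Rightarrow> bool" where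
  "weakly_norming V E \<longleftrightarrow>
     (\<exists>A B. bipartition V E A B) \<and>
     (\<forall>A B. bipartition V E A B \<longrightarrow> norm_on_bounded_measurable (r_norm V E A B))"

end

theory Submission
  imports Defs "HOL-Probability.Infinite_Product_Measure"
begin

text \<open>
  Put a kernel \<open>\<sigma> d\<close> on every edge \<open>d\<close> of \<open>H\<close> and integrate the product. Conditioning on the coordinates
  in the fixed set of a cut involution makes the two sides independent, so Cauchy--Schwarz bounds the
  square of the integral by the product of the integrals for the two foldings of \<open>\<sigma>\<close>. If only two
  kernels \<open>f\<close> and \<open>g\<close> are used, there are finitely many placements, and folding keeps a maximal one
  maximal. A percolating sequence turns it into a constant placement, so every mixed integral is at
  most the larger of the two pure ones. Expanding \<open>\<Prod>(a f + b g)\<close> gives the triangle inequality, and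
  placing a multiple of \<open>f\<close> on one edge and \<open>1\<close> elsewhere gives definiteness. The composed folding map
  sends every edge to a single one, which is why \<open>H\<close> is bipartite.
\<close>

section \<open>Integrals of kernels placed on edges\<close>

text \<open>The factors are indexed by ordered pairs because a kernel need not be symmetric, and
  every pair may carry a kernel of its own. Values in \<open>ennreal\<close> let Tonelli and
  Cauchy-Schwarz apply without integrability conditions.\<close>

definition hom_integral ::
    "'b measure \<Rightarrow> 'a set \<Rightarrow> ('a \<times> 'a) set \<Rightarrow> ('a \<times> 'a \<Rightarrow> 'b \<times> 'b \<Rightarrow> ennreal) \<Rightarrow> ennreal" where
  "hom_integral P V D \<sigma> =
     (\<integral>\<^sup>+x. (\<Prod>d\<in>D. \<sigma> d (x (fst d), x (snd d))) \<partial>Pi\<^sub>M V (\<lambda>_. P))"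

text \<open>The contribution of one side of a separation, conditional on the values \<open>z\<close>
  at the separating set \<open>F\<close>.\<close>

definition half_integral ::
    "'b measure \<Rightarrow> 'a set \<Rightarrow> 'a set \<Rightarrow> ('a \<times> 'a) set \<Rightarrow> ('a \<times> 'a \<Rightarrow> 'b \<times> 'b \<Rightarrow> ennreal) \<Rightarrow>
     ('a \<Rightarrow> 'b) \<Rightarrow> ennreal" where
  "half_integral P F X D \<sigma> z =
     (\<integral>\<^sup>+y. (\<Prod>d\<in>D. \<sigma> d (merge F X (z, y) (fst d), merge F X (z, y) (snd d))) \<partial>Pi\<^sub>M X (\<lambda>_. P))"

section \<open>Tonelli across a separating vertex set\<close>

lemma measurable_edge_product:
  assumes "D \<subseteq> V \<times> V" and "\<And>d. d \<in> D \<Longrightarrow> \<sigma> d \<in> borel_measurable (P \<Otimes>\<^sub>M P)"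
  shows "(\<lambda>x. \<Prod>d\<in>D. (\<sigma> d (x (fst d), x (snd d)) :: ennreal)) \<in> borel_measurable (Pi\<^sub>M V (\<lambda>_. P))"
proof (rule borel_measurable_prod_ennreal)
  fix d assume d: "d \<in> D"
  then have m: "\<sigma> d \<in> borel_measurable (P \<Otimes>\<^sub>M P)" and "fst d \<in> V" "snd d \<in> V"
    using assms by auto
  then show "(\<lambda>x. \<sigma> d (x (fst d), x (snd d))) \<in> borel_measurable (Pi\<^sub>M V (\<lambda>_. P))"
    by (intro measurable_compose[OF _ m] measurable_Pair measurable_component_singleton)
qed

lemma measurable_half_integrand:
  assumes "D \<subseteq> (F \<union> X) \<times> (F \<union> X)" and "\<And>d. d \<in> D \<Longrightarrow> \<sigma> d \<in> borel_measurable (P \<Otimes>\<^sub>M P)"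
  shows "(\<lambda>w. \<Prod>d\<in>D. (\<sigma> d (merge F X w (fst d), merge F X w (snd d)) :: ennreal))
    \<in> borel_measurable (Pi\<^sub>M F (\<lambda>_. P) \<Otimes>\<^sub>M Pi\<^sub>M X (\<lambda>_. P))"
  by (rule measurable_compose[OF measurable_merge measurable_edge_product[OF assms]])

lemma measurable_half_integral:
  assumes "prob_space P" "finite X"
    and "D \<subseteq> (F \<union> X) \<times> (F \<union> X)" "\<And>d. d \<in> D \<Longrightarrow> \<sigma> d \<in> borel_measurable (P \<Otimes>\<^sub>M P)"
  shows "half_integral P F X D \<sigma> \<in> borel_measurable (Pi\<^sub>M F (\<lambda>_. P))"
proof -
  interpret X: prob_space "Pi\<^sub>M X (\<lambda>_. P)"
    using assms(1) by (intro prob_space_PiM)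
  show ?thesis
    unfolding half_integral_def
    using X.borel_measurable_nn_integral[of "\<lambda>z y. \<Prod>d\<in>D. \<sigma> d (merge F X (z, y) (fst d), merge F X (z, y) (snd d))"]
      measurable_half_integrand[OF assms(3,4)]
    by (simp add: case_prod_unfold)
qed

text \<open>Once the coordinates in \<open>F\<close> are fixed, no factor involves both
  \<open>X\<close> and \<open>Y\<close>, so the inner integral factorises by Tonelli; the factors
  over \<open>DF\<close> are constants there.\<close>

lemma hom_integral_split:
  assumes P: "prob_space P"
    and fin: "finite F" "finite X" "finite Y" "finite DF" "finite DX" "finite DY"
    and disj: "F \<inter> X = {}" "F \<inter> Y = {}" "X \<inter> Y = {}"
      "DF \<inter> DX = {}" "DF \<inter> DY = {}" "DX \<inter> DY = {}"
    and sub: "DF \<subseteq> F \<times> F" "DX \<subseteq> (F \<union> X) \<times> (F \<union> X)" "DY \<subseteq> (F \<union> Y) \<times> (F \<union> Y)"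
    and meas: "\<And>d. d \<in> DF \<union> DX \<union> DY \<Longrightarrow> \<sigma> d \<in> borel_measurable (P \<Otimes>\<^sub>M P)"
  shows "hom_integral P (F \<union> X \<union> Y) (DF \<union> DX \<union> DY) \<sigma> =
    (\<integral>\<^sup>+z. (\<Prod>d\<in>DF. \<sigma> d (z (fst d), z (snd d))) *
       (half_integral P F X DX \<sigma> z * half_integral P F Y DY \<sigma> z) \<partial>Pi\<^sub>M F (\<lambda>_. P))"
proof -
  interpret product_sigma_finite "\<lambda>_. P"
    using P by (simp add: product_sigma_finite_def prob_space_imp_sigma_finite)
  let ?f = "\<lambda>D x. \<Prod>d\<in>D. \<sigma> d (x (fst d), x (snd d))"
  have mV: "?f (DF \<union> DX \<union> DY) \<in> borel_measurable (Pi\<^sub>M (F \<union> (X \<union> Y)) (\<lambda>_. P))"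
    using sub by (intro measurable_edge_product meas) auto
  have "hom_integral P (F \<union> X \<union> Y) (DF \<union> DX \<union> DY) \<sigma> =
    (\<integral>\<^sup>+z. \<integral>\<^sup>+w. ?f (DF \<union> DX \<union> DY) (merge F (X \<union> Y) (z, w)) \<partial>Pi\<^sub>M (X \<union> Y) (\<lambda>_. P) \<partial>Pi\<^sub>M F (\<lambda>_. P))"
    unfolding hom_integral_def Un_assoc
    using mV disj fin by (subst product_nn_integral_fold) (auto simp: Un_assoc)
  also have "\<dots> = (\<integral>\<^sup>+z. ?f DF z * (half_integral P F X DX \<sigma> z * half_integral P F Y DY \<sigma> z) \<partial>Pi\<^sub>M F (\<lambda>_. P))"
  proof (rule nn_integral_cong)
    fix z assume z: "z \<in> space (Pi\<^sub>M F (\<lambda>_. P))"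
    have m: "(\<lambda>w. ?f (DF \<union> DX \<union> DY) (merge F (X \<union> Y) (z, w))) \<in> borel_measurable (Pi\<^sub>M (X \<union> Y) (\<lambda>_. P))"
      using measurable_compose[OF measurable_Pair1'[OF z, of "Pi\<^sub>M (X \<union> Y) (\<lambda>_. P)"]
          measurable_compose[OF measurable_merge mV]] by simp
    have mX: "(\<lambda>y. ?f DX (merge F X (z, y))) \<in> borel_measurable (Pi\<^sub>M X (\<lambda>_. P))"
      using measurable_compose[OF measurable_Pair1'[OF z, of "Pi\<^sub>M X (\<lambda>_. P)"]
          measurable_half_integrand[OF sub(2), of \<sigma>]] meas by simp
    have mY: "(\<lambda>y. ?f DY (merge F Y (z, y))) \<in> borel_measurable (Pi\<^sub>M Y (\<lambda>_. P))"
      using measurable_compose[OF measurable_Pair1'[OF z, of "Pi\<^sub>M Y (\<lambda>_. P)"]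
          measurable_half_integrand[OF sub(3), of \<sigma>]] meas by simp
    \<comment> \<open>With \<open>z\<close> fixed, each of the three groups of factors sees only its
      own coordinates.\<close>
    have e: "?f (DF \<union> DX \<union> DY) (merge F (X \<union> Y) (z, merge X Y (x, y))) =
        ?f DF z * ?f DX (merge F X (z, x)) * ?f DY (merge F Y (z, y))" for x y
    proof -
      have 1: "?f DF (merge F (X \<union> Y) (z, merge X Y (x, y))) = ?f DF z"
        using sub by (intro prod.cong refl) (auto simp: merge_def)
      have 2: "?f DX (merge F (X \<union> Y) (z, merge X Y (x, y))) = ?f DX (merge F X (z, x))"
        using sub disj by (intro prod.cong refl) (auto simp: merge_def)
      have "merge F (X \<union> Y) (z, merge X Y (x, y)) v = merge F Y (z, y) v" if "v \<in> F \<union> Y" for v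
        using that disj by (auto simp: merge_def)
      with sub(3) have 3: "?f DY (merge F (X \<union> Y) (z, merge X Y (x, y))) = ?f DY (merge F Y (z, y))"
        by (intro prod.cong refl) (auto simp: subset_iff)
      show ?thesis
        using fin disj by (subst prod.union_disjoint, simp, simp, blast)+ (simp only: 1 2 3)
    qed
    have "(\<integral>\<^sup>+w. ?f (DF \<union> DX \<union> DY) (merge F (X \<union> Y) (z, w)) \<partial>Pi\<^sub>M (X \<union> Y) (\<lambda>_. P)) =
      (\<integral>\<^sup>+x. \<integral>\<^sup>+y. ?f DF z * ?f DX (merge F X (z, x)) * ?f DY (merge F Y (z, y)) \<partial>Pi\<^sub>M Y (\<lambda>_. P) \<partial>Pi\<^sub>M X (\<lambda>_. P))"
      using m disj fin by (subst product_nn_integral_fold) (auto simp: e)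
    also have "\<dots> = ?f DF z * (half_integral P F X DX \<sigma> z * half_integral P F Y DY \<sigma> z)"
      unfolding half_integral_def
      using mX mY by (simp add: nn_integral_cmult nn_integral_multc mult.assoc)
    finally show "(\<integral>\<^sup>+w. ?f (DF \<union> DX \<union> DY) (merge F (X \<union> Y) (z, w)) \<partial>Pi\<^sub>M (X \<union> Y) (\<lambda>_. P)) =
       ?f DF z * (half_integral P F X DX \<sigma> z * half_integral P F Y DY \<sigma> z)" .
  qed
  finally show ?thesis .
qed

text \<open>All coordinates have the same law, so renaming them along the bijection
  \<open>\<phi>\<close> preserves the product measure. Since \<open>\<phi>\<close> fixes
  \<open>F\<close>, the conditioned values \<open>z\<close> stay where they are.\<close>

lemma half_integral_reindex:
  assumes P: "prob_space P"
    and \<phi>: "bij_betw \<phi> Y X" "\<And>v. v \<in> F \<Longrightarrow> \<phi> v = v" and disj: "F \<inter> X = {}" "F \<inter> Y = {}"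
    and D: "D \<subseteq> (F \<union> Y) \<times> (F \<union> Y)"
    and z: "z \<in> space (Pi\<^sub>M F (\<lambda>_. P))"
    and meas: "\<And>d. d \<in> D \<Longrightarrow> \<sigma> (map_prod \<phi> \<phi> d) \<in> borel_measurable (P \<Otimes>\<^sub>M P)"
  shows "half_integral P F Y D (\<lambda>d. \<sigma> (map_prod \<phi> \<phi> d)) z =
    half_integral P F X (map_prod \<phi> \<phi> ` D) \<sigma> z"
proof -
  let ?t = "\<lambda>\<omega>. \<lambda>n\<in>Y. \<omega> (\<phi> n)"
  \<comment> \<open>Injectivity must hold on \<open>F\<close> and \<open>Y\<close> together, since a
    pair may join them; it turns the product over \<open>D\<close> into a product over its
    image.\<close>
  have inj: "inj_on \<phi> (F \<union> Y)"
    using \<phi> disj unfolding bij_betw_def inj_on_def by (metis Un_iff disjoint_iff imageI)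
  then have inj': "inj_on (map_prod \<phi> \<phi>) D"
    using D by (intro inj_on_subset[OF map_prod_inj_on D]) auto
  have distr: "distr (Pi\<^sub>M X (\<lambda>_. P)) (Pi\<^sub>M Y (\<lambda>_. P)) ?t = Pi\<^sub>M Y (\<lambda>_. P)"
    using distr_PiM_reindex[of X "\<lambda>_. P" \<phi> Y] P \<phi> by (auto simp: bij_betw_def)
  have t: "?t \<in> Pi\<^sub>M X (\<lambda>_. P) \<rightarrow>\<^sub>M Pi\<^sub>M Y (\<lambda>_. P)"
    using \<phi>(1) by (intro measurable_restrict measurable_component_singleton) (auto simp: bij_betw_def)
  have mY: "(\<lambda>y. \<Prod>d\<in>D. \<sigma> (map_prod \<phi> \<phi> d) (merge F Y (z, y) (fst d), merge F Y (z, y) (snd d)))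
      \<in> borel_measurable (Pi\<^sub>M Y (\<lambda>_. P))"
    using measurable_compose[OF measurable_Pair1'[OF z, of "Pi\<^sub>M Y (\<lambda>_. P)"]
        measurable_half_integrand[OF D, of "\<lambda>d. \<sigma> (map_prod \<phi> \<phi> d)"]] meas by simp
  have merge: "merge F Y (z, ?t \<omega>) v = merge F X (z, \<omega>) (\<phi> v)" if "v \<in> F \<union> Y" for v \<omega>
    using that \<phi> disj by (auto simp: merge_def bij_betw_def)
  have "half_integral P F Y D (\<lambda>d. \<sigma> (map_prod \<phi> \<phi> d)) z =
     (\<integral>\<^sup>+\<omega>. (\<Prod>d\<in>D. \<sigma> (map_prod \<phi> \<phi> d) (merge F Y (z, ?t \<omega>) (fst d), merge F Y (z, ?t \<omega>) (snd d)))
        \<partial>Pi\<^sub>M X (\<lambda>_. P))"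
    unfolding half_integral_def
    by (subst distr[symmetric], subst nn_integral_distr[OF t]) (use mY in auto)
  also have "\<dots> = half_integral P F X (map_prod \<phi> \<phi> ` D) \<sigma> z"
    unfolding half_integral_def
  proof (rule nn_integral_cong)
    fix \<omega>
    have "(\<Prod>d\<in>D. \<sigma> (map_prod \<phi> \<phi> d) (merge F Y (z, ?t \<omega>) (fst d), merge F Y (z, ?t \<omega>) (snd d))) =
      (\<Prod>d\<in>D. \<sigma> (map_prod \<phi> \<phi> d) (merge F X (z, \<omega>) (fst (map_prod \<phi> \<phi> d)), merge F X (z, \<omega>) (snd (map_prod \<phi> \<phi> d))))"
    proof (intro prod.cong refl)
      fix d assume "d \<in> D"
      then have "fst d \<in> F \<union> Y" "snd d \<in> F \<union> Y"
        using D by auto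
      then show "\<sigma> (map_prod \<phi> \<phi> d) (merge F Y (z, ?t \<omega>) (fst d), merge F Y (z, ?t \<omega>) (snd d)) =
        \<sigma> (map_prod \<phi> \<phi> d) (merge F X (z, \<omega>) (fst (map_prod \<phi> \<phi> d)), merge F X (z, \<omega>) (snd (map_prod \<phi> \<phi> d)))"
        by (simp only: merge fst_map_prod snd_map_prod)
    qed
    also have "\<dots> = (\<Prod>d\<in>map_prod \<phi> \<phi> ` D. \<sigma> d (merge F X (z, \<omega>) (fst d), merge F X (z, \<omega>) (snd d)))"
      using inj' by (simp add: prod.reindex)
    finally show "(\<Prod>d\<in>D. \<sigma> (map_prod \<phi> \<phi> d) (merge F Y (z, ?t \<omega>) (fst d), merge F Y (z, ?t \<omega>) (snd d))) =
      (\<Prod>d\<in>map_prod \<phi> \<phi> ` D. \<sigma> d (merge F X (z, \<omega>) (fst d), merge F X (z, \<omega>) (snd d)))" .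
  qed
  finally show ?thesis .
qed

section \<open>Folding and percolation\<close>

text \<open>What the Cauchy-Schwarz step takes from a cut involution: a reflection that preserves
  the ordered pairs in \<open>D\<close>, none of which joins the two sides. The condition is
  symmetric in \<open>X\<close> and \<open>Y\<close>, so it serves both foldings.\<close>

definition fold_symmetry ::
    "'a set \<Rightarrow> ('a \<times> 'a) set \<Rightarrow> ('a \<Rightarrow> 'a) \<Rightarrow> 'a set \<Rightarrow> 'a set \<Rightarrow> bool" where
  "fold_symmetry V D \<phi> X Y \<longleftrightarrow>
     X \<union> Y \<subseteq> V \<and> X \<inter> Y = {} \<and> \<phi> ` X = Y \<and> \<phi> ` Y = X \<and>
     (\<forall>v\<in>V. \<phi> (\<phi> v) = v) \<and> (\<forall>v\<in>V - (X \<union> Y). \<phi> v = v) \<and>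
     map_prod \<phi> \<phi> ` D \<subseteq> D \<and> D \<subseteq> V \<times> V \<and> D \<inter> (X \<times> Y \<union> Y \<times> X) = {}"

lemma fold_symmetry_commute: "fold_symmetry V D \<phi> X Y \<longleftrightarrow> fold_symmetry V D \<phi> Y X"
  unfolding fold_symmetry_def by (auto simp: Un_commute Int_commute)

lemma fold_symmetryD:
  assumes "fold_symmetry V D \<phi> X Y"
  shows "X \<union> Y \<subseteq> V" "X \<inter> Y = {}" "\<phi> ` X = Y" "\<phi> ` Y = X"
    "D \<subseteq> V \<times> V" "D \<inter> (X \<times> Y \<union> Y \<times> X) = {}"
    "\<And>v. v \<in> V \<Longrightarrow> \<phi> (\<phi> v) = v" "\<And>v. v \<in> V - (X \<union> Y) \<Longrightarrow> \<phi> v = v"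
    "\<And>u v. (u, v) \<in> D \<Longrightarrow> (\<phi> u, \<phi> v) \<in> D"
proof -
  note sym = assms[unfolded fold_symmetry_def]
  show "X \<union> Y \<subseteq> V" "X \<inter> Y = {}" "\<phi> ` X = Y" "\<phi> ` Y = X"
    "D \<subseteq> V \<times> V" "D \<inter> (X \<times> Y \<union> Y \<times> X) = {}"
    using sym by - (elim conjE, assumption)+
  show "\<phi> (\<phi> v) = v" if "v \<in> V" for v
    using sym that by (elim conjE) (rule bspec)
  show "\<phi> v = v" if "v \<in> V - (X \<union> Y)" for v
    using sym that by (elim conjE) (rule bspec)
  have "map_prod \<phi> \<phi> ` D \<subseteq> D"
    using sym by (elim conjE)
  then show "(\<phi> u, \<phi> v) \<in> D" if "(u, v) \<in> D" for u v
    using that by (metis image_subset_iff map_prod_simp)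
qed

text \<open>A pair in \<open>D\<close> never has one end on each side, and vertices off both sides
  are fixed, so the folding map acts on a whole pair either as the identity or as
  \<open>\<phi>\<close>.\<close>

lemma fold_map_edge:
  assumes sym: "fold_symmetry V D \<phi> X Y" and "d \<in> D"
  shows "map_prod (fold_map \<phi> Y) (fold_map \<phi> Y) d \<in> D"
proof -
  note fold = fold_symmetryD[OF sym]
  obtain u v where d: "d = (u, v)" "(u, v) \<in> D"
    using assms by (cases d) auto
  then have V: "u \<in> V" "v \<in> V" and cross: "\<not> (u \<in> X \<and> v \<in> Y)" "\<not> (u \<in> Y \<and> v \<in> X)"
    using fold(5,6) by blast+
  have fix_out: "\<phi> w = w" if "w \<in> V" "w \<notin> X" "w \<notin> Y" for w
    using fold(8) that by blast
  have img: "(\<phi> u, \<phi> v) \<in> D"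
    using fold(9) d by blast
  have "fold_map \<phi> Y u = u \<and> fold_map \<phi> Y v = v \<or> fold_map \<phi> Y u = \<phi> u \<and> fold_map \<phi> Y v = \<phi> v"
    unfolding fold_map_def using fix_out[OF V(1)] fix_out[OF V(2)] cross by metis
  then show ?thesis
    using d(2) img unfolding d(1) by (elim disjE conjE) simp_all
qed

text \<open>Folding onto \<open>X\<close> replaces the half over \<open>Y\<close> by a mirror copy
  of the half over \<open>X\<close>, which turns the mixed product into a square.\<close>

lemma hom_integral_fold:
  assumes P: "prob_space P" and sym: "fold_symmetry V D \<phi> X Y" and fin: "finite V"
    and F: "F = V - (X \<union> Y)" and DF: "DF = D \<inter> F \<times> F"
    and DX: "DX = D \<inter> (F \<union> X) \<times> (F \<union> X) - F \<times> F"
    and DY: "DY = D \<inter> (F \<union> Y) \<times> (F \<union> Y) - F \<times> F"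
    and meas: "\<And>d. d \<in> D \<Longrightarrow> \<sigma> d \<in> borel_measurable (P \<Otimes>\<^sub>M P)"
  shows "hom_integral P V D \<sigma> = (\<integral>\<^sup>+z. (\<Prod>d\<in>DF. \<sigma> d (z (fst d), z (snd d))) *
       (half_integral P F X DX \<sigma> z * half_integral P F Y DY \<sigma> z) \<partial>Pi\<^sub>M F (\<lambda>_. P))" (is ?split)
    and "hom_integral P V D (\<lambda>d. \<sigma> (map_prod (fold_map \<phi> Y) (fold_map \<phi> Y) d)) =
      (\<integral>\<^sup>+z. (\<Prod>d\<in>DF. \<sigma> d (z (fst d), z (snd d))) * (half_integral P F X DX \<sigma> z)\<^sup>2 \<partial>Pi\<^sub>M F (\<lambda>_. P))"
      (is ?fold)
proof -
  let ?p = "fold_map \<phi> Y"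
  note XY = fold_symmetryD(1,2)[OF sym] and swap = fold_symmetryD(3,4)[OF sym]
    and DV = fold_symmetryD(5)[OF sym] and cross = fold_symmetryD(6)[OF sym]
    and inv = fold_symmetryD(7)[OF sym] and fix_F = fold_symmetryD(8)[OF sym, folded F]
    and img = fold_symmetryD(9)[OF sym]
  have V: "V = F \<union> X \<union> Y"
    using XY F by blast
  \<comment> \<open>These three sets exhaust \<open>D\<close> because no pair crosses between
    \<open>X\<close> and \<open>Y\<close>.\<close>
  have D: "D = DF \<union> DX \<union> DY"
    using DV cross unfolding V DF DX DY by blast
  have "finite D"
    using DV fin by (meson finite_SigmaI finite_subset)
  then have fins: "finite F" "finite X" "finite Y" "finite DF" "finite DX" "finite DY"
    using fin D V by (metis finite_Un)+
  have disj: "F \<inter> X = {}" "F \<inter> Y = {}" "X \<inter> Y = {}"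
    "DF \<inter> DX = {}" "DF \<inter> DY = {}" "DX \<inter> DY = {}"
    using XY F DF DX DY by blast+
  have sub: "DF \<subseteq> F \<times> F" "DX \<subseteq> (F \<union> X) \<times> (F \<union> X)" "DY \<subseteq> (F \<union> Y) \<times> (F \<union> Y)"
    using DF DX DY by blast+
  have split: "hom_integral P V D \<rho> = (\<integral>\<^sup>+z. (\<Prod>d\<in>DF. \<rho> d (z (fst d), z (snd d))) *
       (half_integral P F X DX \<rho> z * half_integral P F Y DY \<rho> z) \<partial>Pi\<^sub>M F (\<lambda>_. P))"
    if "\<And>d. d \<in> D \<Longrightarrow> \<rho> d \<in> borel_measurable (P \<Otimes>\<^sub>M P)" for \<rho>
    using hom_integral_split[OF P fins disj sub, of \<rho>] that unfolding D[symmetric] V[symmetric]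
    by blast
  show ?split
    using meas by (rule split)
  have bij: "bij_betw \<phi> Y X"
    unfolding bij_betw_def
  proof
    show "inj_on \<phi> Y"
      by (rule inj_on_inverseI[where g=\<phi>]) (use inv XY in blast)
  qed (rule swap)
  \<comment> \<open>Stated for arbitrary sides because it is applied from \<open>Y\<close> to
    \<open>X\<close> and back; the way back, with \<open>\<phi>\<close> involutive, gives
    surjectivity onto \<open>DX\<close>.\<close>
  have image_sub: "map_prod \<phi> \<phi> ` (D \<inter> (F \<union> Z) \<times> (F \<union> Z) - F \<times> F) \<subseteq> D \<inter> (F \<union> Z') \<times> (F \<union> Z') - F \<times> F"
    if "\<phi> ` Z = Z'" for Z Z'
  proof
    fix e assume "e \<in> map_prod \<phi> \<phi> ` (D \<inter> (F \<union> Z) \<times> (F \<union> Z) - F \<times> F)"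
    then obtain u v where uv: "(u, v) \<in> D" "u \<in> F \<union> Z" "v \<in> F \<union> Z" "\<not> (u \<in> F \<and> v \<in> F)"
      and e: "e = (\<phi> u, \<phi> v)"
      by auto
    have mem: "\<phi> w \<in> F \<union> Z'" if "w \<in> F \<union> Z" for w
      using that \<open>\<phi> ` Z = Z'\<close> fix_F by auto
    have "w \<in> F" if "\<phi> w \<in> F" "w \<in> V" for w
      using fix_F[OF that(1)] inv[OF that(2)] that by simp
    then have "\<not> (\<phi> u \<in> F \<and> \<phi> v \<in> F)"
      using uv DV by blast
    then show "e \<in> D \<inter> (F \<union> Z') \<times> (F \<union> Z') - F \<times> F"
      using mem uv img e by blast
  qed
  have image_DY: "map_prod \<phi> \<phi> ` DY = DX"
  proof
    show "map_prod \<phi> \<phi> ` DY \<subseteq> DX"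
      unfolding DX DY by (rule image_sub) (rule swap)
    show "DX \<subseteq> map_prod \<phi> \<phi> ` DY"
    proof
      fix e assume e: "e \<in> DX"
      have "map_prod \<phi> \<phi> e \<in> DY"
        unfolding DY by (rule subsetD[OF image_sub[OF swap(1)] imageI]) (use e DX in simp)
      moreover obtain u v where "e = (u, v)" "u \<in> V" "v \<in> V"
        using e DV DX by blast
      then have "e = map_prod \<phi> \<phi> (map_prod \<phi> \<phi> e)"
        by (simp add: inv)
      ultimately show "e \<in> map_prod \<phi> \<phi> ` DY"
        by (metis imageI)
    qed
  qed
  have fix1: "map_prod ?p ?p d = d" if "d \<in> DF \<union> DX" for d
  proof -
    have "d \<in> (F \<union> X) \<times> (F \<union> X)"
      using that sub(1,2) by blast
    then obtain u v where uv: "d = (u, v)" "u \<in> F \<union> X" "v \<in> F \<union> X"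
      by blast
    then have "u \<notin> Y" "v \<notin> Y"
      using disj(2,3) by blast+
    with uv(1) show ?thesis
      by (simp add: fold_map_def)
  qed
  have fix2: "map_prod ?p ?p d = map_prod \<phi> \<phi> d" if "d \<in> DY" for d
  proof -
    have "d \<in> (F \<union> Y) \<times> (F \<union> Y)"
      using that sub(3) by blast
    then obtain u v where "d = (u, v)" "u \<in> F \<union> Y" "v \<in> F \<union> Y"
      by blast
    then show ?thesis
      using fix_F by (auto simp: fold_map_def)
  qed
  have halfX: "half_integral P F X DX (\<lambda>d. \<sigma> (map_prod ?p ?p d)) = half_integral P F X DX \<sigma>"
    unfolding half_integral_def using fix1 by (intro ext nn_integral_cong prod.cong) auto
  have halfY: "half_integral P F Y DY (\<lambda>d. \<sigma> (map_prod ?p ?p d)) z = half_integral P F X DX \<sigma> z"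
    if z: "z \<in> space (Pi\<^sub>M F (\<lambda>_. P))" for z
  proof -
    have "half_integral P F Y DY (\<lambda>d. \<sigma> (map_prod ?p ?p d)) z = half_integral P F Y DY (\<lambda>d. \<sigma> (map_prod \<phi> \<phi> d)) z"
      unfolding half_integral_def using fix2 by (intro nn_integral_cong prod.cong) auto
    also have "\<dots> = half_integral P F X (map_prod \<phi> \<phi> ` DY) \<sigma> z"
    proof (rule half_integral_reindex[OF P bij fix_F disj(1,2) sub(3) z])
      fix d assume "d \<in> DY"
      then have "map_prod \<phi> \<phi> d \<in> D"
        using image_DY D by blast
      then show "\<sigma> (map_prod \<phi> \<phi> d) \<in> borel_measurable (P \<Otimes>\<^sub>M P)"
        by (rule meas)
    qed
    finally show ?thesis
      by (simp only: image_DY)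
  qed
  have prodF: "(\<Prod>d\<in>DF. \<sigma> (map_prod ?p ?p d) (z (fst d), z (snd d))) = (\<Prod>d\<in>DF. \<sigma> d (z (fst d), z (snd d)))" for z
    using fix1 by (intro prod.cong) auto
  have "hom_integral P V D (\<lambda>d. \<sigma> (map_prod ?p ?p d)) =
      (\<integral>\<^sup>+z. (\<Prod>d\<in>DF. \<sigma> d (z (fst d), z (snd d))) *
       (half_integral P F X DX \<sigma> z * half_integral P F Y DY (\<lambda>d. \<sigma> (map_prod ?p ?p d)) z) \<partial>Pi\<^sub>M F (\<lambda>_. P))"
    by (subst split, rule meas, rule fold_map_edge[OF sym], assumption, simp only: halfX prodF)
  also have "\<dots> = (\<integral>\<^sup>+z. (\<Prod>d\<in>DF. \<sigma> d (z (fst d), z (snd d))) * (half_integral P F X DX \<sigma> z)\<^sup>2 \<partial>Pi\<^sub>M F (\<lambda>_. P))"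
    by (intro nn_integral_cong) (simp only: halfY power2_eq_square)
  finally show ?fold .
qed

text \<open>Cauchy-Schwarz for the conditional halves \<open>h\<close> and \<open>k\<close>: the
  original integral is that of \<open>h * k\<close>, and the two foldings give the integrals of
  their squares.\<close>

lemma hom_integral_fold_le:
  assumes P: "prob_space P" and sym: "fold_symmetry V D \<phi> X Y" and fin: "finite V"
    and meas: "\<And>d. d \<in> D \<Longrightarrow> \<sigma> d \<in> borel_measurable (P \<Otimes>\<^sub>M P)"
  shows "(hom_integral P V D \<sigma>)\<^sup>2 \<le>
    hom_integral P V D (\<lambda>d. \<sigma> (map_prod (fold_map \<phi> Y) (fold_map \<phi> Y) d)) *
    hom_integral P V D (\<lambda>d. \<sigma> (map_prod (fold_map \<phi> X) (fold_map \<phi> X) d))"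
proof -
  define F where "F = V - (X \<union> Y)"
  define DF where "DF = D \<inter> F \<times> F"
  define DX where "DX = D \<inter> (F \<union> X) \<times> (F \<union> X) - F \<times> F"
  define DY where "DY = D \<inter> (F \<union> Y) \<times> (F \<union> Y) - F \<times> F"
  define G where "G = (\<lambda>z. \<Prod>d\<in>DF. \<sigma> d (z (fst d), z (snd d)))"
  define h where "h = half_integral P F X DX \<sigma>"
  define k where "k = half_integral P F Y DY \<sigma>"
  \<comment> \<open>Pairs with both ends in \<open>F\<close> belong to neither half. Their product
    \<open>G\<close> is common to all three integrals and becomes a weight on the measure.\<close>
  let ?N = "density (Pi\<^sub>M F (\<lambda>_. P)) G"
  have fins: "finite X" "finite Y"
    using fold_symmetryD(1)[OF sym] fin by (auto intro: finite_subset)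
  have G [measurable]: "G \<in> borel_measurable (Pi\<^sub>M F (\<lambda>_. P))"
    unfolding G_def by (rule measurable_edge_product) (use meas in \<open>auto simp: DF_def\<close>)
  have h [measurable]: "h \<in> borel_measurable (Pi\<^sub>M F (\<lambda>_. P))"
    unfolding h_def by (rule measurable_half_integral) (use P fins meas in \<open>auto simp: DX_def\<close>)
  have k [measurable]: "k \<in> borel_measurable (Pi\<^sub>M F (\<lambda>_. P))"
    unfolding k_def by (rule measurable_half_integral) (use P fins meas in \<open>auto simp: DY_def\<close>)
  have F': "F = V - (Y \<union> X)"
    by (auto simp: F_def)
  \<comment> \<open>With the sides exchanged, the same formula yields the second folding.\<close>
  have sym': "fold_symmetry V D \<phi> Y X"
    using sym by (simp add: fold_symmetry_commute)
  have "hom_integral P V D \<sigma> = (\<integral>\<^sup>+z. h z * k z \<partial>?N)"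
    using hom_integral_fold(1)[OF P sym fin F_def DF_def DX_def DY_def, of \<sigma>] meas
    by (simp add: nn_integral_density G_def[symmetric] h_def[symmetric] k_def[symmetric])
      (simp add: G_def)
  moreover have "hom_integral P V D (\<lambda>d. \<sigma> (map_prod (fold_map \<phi> Y) (fold_map \<phi> Y) d)) = (\<integral>\<^sup>+z. (h z)\<^sup>2 \<partial>?N)"
    using hom_integral_fold(2)[OF P sym fin F_def DF_def DX_def DY_def, of \<sigma>] meas
    by (simp add: nn_integral_density h_def[symmetric]) (simp add: G_def)
  moreover have "hom_integral P V D (\<lambda>d. \<sigma> (map_prod (fold_map \<phi> X) (fold_map \<phi> X) d)) = (\<integral>\<^sup>+z. (k z)\<^sup>2 \<partial>?N)"
    using hom_integral_fold(2)[OF P sym' fin F' DF_def DY_def DX_def, of \<sigma>] meas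
    by (simp add: nn_integral_density k_def[symmetric]) (simp add: G_def)
  moreover have "(\<integral>\<^sup>+z. h z * k z \<partial>?N)\<^sup>2 \<le> (\<integral>\<^sup>+z. (h z)\<^sup>2 \<partial>?N) * (\<integral>\<^sup>+z. (k z)\<^sup>2 \<partial>?N)"
    by (rule Cauchy_Schwarz_nn_integral) auto
  ultimately show ?thesis
    by simp
qed

text \<open>A new fold is composed on the right and so acts first: folding a placement
  \<open>\<tau> \<circ> q\<close> precomposes it with the folding map, just as edge sets are pulled
  back.\<close>

inductive_set fold_monoid :: "'a set \<Rightarrow> ('a \<times> 'a) set \<Rightarrow> ('a \<Rightarrow> 'a) set" for V D where
  id: "id \<in> fold_monoid V D"
| fold: "q \<in> fold_monoid V D \<Longrightarrow> fold_symmetry V D \<phi> X Y \<Longrightarrow> q \<circ> fold_map \<phi> Y \<in> fold_monoid V D"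

section \<open>Extremal placements of two kernels\<close>

lemma hom_integral_cong:
  "(\<And>d. d \<in> D \<Longrightarrow> \<sigma> d = \<rho> d) \<Longrightarrow> hom_integral P V D \<sigma> = hom_integral P V D \<rho>"
  unfolding hom_integral_def by (intro nn_integral_cong prod.cong) auto

lemma hom_integral_mono:
  assumes "\<And>d z. d \<in> D \<Longrightarrow> \<sigma> d z \<le> \<rho> d z"
  shows "hom_integral P V D \<sigma> \<le> hom_integral P V D \<rho>"
  unfolding hom_integral_def by (intro nn_integral_mono prod_mono_ennreal) (use assms in auto)

lemma hom_integral_const:
  assumes "prob_space P"
  shows "hom_integral P V D (\<lambda>_ _. c) = c ^ card D"
proof -
  interpret prob_space "Pi\<^sub>M V (\<lambda>_. P)"
    using assms by (intro prob_space_PiM)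
  show ?thesis
    by (simp add: hom_integral_def emeasure_space_1)
qed

lemma hom_integral_cmult:
  assumes "D \<subseteq> V \<times> V" "\<And>d. d \<in> D \<Longrightarrow> \<sigma> d \<in> borel_measurable (P \<Otimes>\<^sub>M P)"
  shows "hom_integral P V D (\<lambda>d z. c d * \<sigma> d z) = (\<Prod>d\<in>D. c d) * hom_integral P V D \<sigma>"
  unfolding hom_integral_def
  by (simp add: prod.distrib nn_integral_cmult measurable_edge_product[OF assms])

text \<open>Extremal argument: let \<open>M\<close> be the maximal integral over all placements of
  \<open>f\<close> and \<open>g\<close>. By \<open>hom_integral_fold_le\<close>, the square of
  \<open>M\<close> is at most the product of two values that do not exceed \<open>M\<close>, so
  folding keeps a maximal placement maximal. Folding along \<open>q\<close> ends with a single
  kernel on all pairs.\<close>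

lemma hom_integral_two_functions_le:
  fixes V :: "'v set"
  assumes P: "prob_space P" and fin: "finite V" and D: "D \<subseteq> V \<times> V"
    and f: "f \<in> borel_measurable (P \<Otimes>\<^sub>M P)" and g: "g \<in> borel_measurable (P \<Otimes>\<^sub>M P)"
    and bound: "\<And>z. f z \<le> C" "\<And>z. g z \<le> C" "C < \<infinity>"
    and q: "q \<in> fold_monoid V D" and const: "\<And>d. d \<in> D \<Longrightarrow> map_prod q q d = d0"
  shows "hom_integral P V D (\<lambda>d. if d \<in> S then f else g) \<le>
    max (hom_integral P V D (\<lambda>_. f)) (hom_integral P V D (\<lambda>_. g))"
proof -
  define h where "h \<tau> = hom_integral P V D (\<lambda>d. if \<tau> d then f else g)" for \<tau> :: "'v \<times> 'v \<Rightarrow> bool"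
  have finD: "finite D"
    using D fin by (meson finite_SigmaI finite_subset)
  \<comment> \<open>Only the values of \<open>\<tau>\<close> on the finite set \<open>D\<close>
    matter, so \<open>h\<close> takes finitely many values and its maximum is attained.\<close>
  have "range h \<subseteq> (\<lambda>S. h (\<lambda>d. d \<in> S)) ` Pow D"
  proof
    fix y assume "y \<in> range h"
    then obtain \<tau> where y: "y = h \<tau>" by auto
    have "h \<tau> = h (\<lambda>d. d \<in> {d \<in> D. \<tau> d})"
      unfolding h_def by (rule hom_integral_cong) auto
    then show "y \<in> (\<lambda>S. h (\<lambda>d. d \<in> S)) ` Pow D"
      unfolding y by blast
  qed
  then have finh: "finite (range h)"
    using finD by (meson finite_Pow_iff finite_imageI finite_subset)
  define M where "M = Max (range h)"
  have le_M: "h \<tau> \<le> M" for \<tau>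
    unfolding M_def using finh by simp
  have "M \<in> range h"
    unfolding M_def using finh by (intro Max_in) auto
  then obtain \<tau> where \<tau>: "h \<tau> = M" by auto
  \<comment> \<open>The uniform bound \<open>C\<close> makes \<open>M\<close> finite, which permits
    cancelling it below.\<close>
  have "M \<le> hom_integral P V D (\<lambda>_ _. C)"
    unfolding \<tau>[symmetric] h_def by (rule hom_integral_mono) (use bound in auto)
  also have "\<dots> < \<infinity>"
    using bound(3) by (simp add: hom_integral_const[OF P] power_less_top_ennreal)
  finally have M_fin: "M < \<infinity>" .
  have "h (\<lambda>d. \<tau> (map_prod q q d)) = M"
    using q
  proof induction
    case id
    then show ?case using \<tau> by (simp add: map_prod.id)
  next
    case (fold q \<phi> X Y)
    let ?\<tau> = "\<lambda>d. \<tau> (map_prod q q d)"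
    let ?\<tau>' = "\<lambda>Z d. ?\<tau> (map_prod (fold_map \<phi> Z) (fold_map \<phi> Z) d)"
    have "(h ?\<tau>)\<^sup>2 \<le> h (?\<tau>' Y) * h (?\<tau>' X)"
      unfolding h_def
      by (rule hom_integral_fold_le[OF P fold.hyps(2) fin, of "\<lambda>d. if ?\<tau> d then f else g"])
        (use f g in auto)
    also have "\<dots> \<le> h (?\<tau>' Y) * M"
      by (intro mult_left_mono le_M) auto
    finally have "M * M \<le> M * h (?\<tau>' Y)"
      by (simp add: fold.IH power2_eq_square mult.commute)
    \<comment> \<open>Cancellation requires \<open>M\<close> to be nonzero; for \<open>M = 0\<close>
      the claim is trivial.\<close>
    then have "M \<le> h (?\<tau>' Y)"
      using M_fin by (cases "M = 0") (auto simp: ennreal_mult_le_mult_iff)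
    then have "h (?\<tau>' Y) = M"
      using le_M by (intro antisym)
    then show ?case
      by (simp add: map_prod.comp[symmetric] comp_def map_prod_def case_prod_unfold)
  qed
  \<comment> \<open>Every pair is sent to \<open>d0\<close>, so the folded placement puts one kernel
    everywhere, and \<open>\<tau> d0\<close> decides whether it is \<open>f\<close> or
    \<open>g\<close>.\<close>
  then have "M = h (\<lambda>_. \<tau> d0)"
    unfolding h_def using const by (auto cong: hom_integral_cong)
  also have "\<dots> \<le> max (hom_integral P V D (\<lambda>_. f)) (hom_integral P V D (\<lambda>_. g))"
    by (auto simp: h_def)
  finally show ?thesis
    using le_M[of "\<lambda>d. d \<in> S"] by (simp add: h_def)
qed

text \<open>Triangle inequality in normalised form. Multiplying out gives one mixed integral for
  each subset \<open>S\<close> of \<open>D\<close>; each is at most 1, and the coefficients add up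
  to the right-hand side.\<close>

lemma hom_integral_add_le:
  fixes V :: "'v set"
  assumes P: "prob_space P" and fin: "finite V" and D: "D \<subseteq> V \<times> V"
    and f: "f \<in> borel_measurable (P \<Otimes>\<^sub>M P)" and g: "g \<in> borel_measurable (P \<Otimes>\<^sub>M P)"
    and bound: "\<And>z. f z \<le> C" "\<And>z. g z \<le> C" "C < \<infinity>"
    and q: "q \<in> fold_monoid V D" and const: "\<And>d. d \<in> D \<Longrightarrow> map_prod q q d = d0"
    and le_1: "hom_integral P V D (\<lambda>_. f) \<le> 1" "hom_integral P V D (\<lambda>_. g) \<le> 1"
  shows "hom_integral P V D (\<lambda>_ z. a * f z + b * g z) \<le> (a + b) ^ card D"
proof -
  have finD: "finite D"
    using D fin by (meson finite_SigmaI finite_subset)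
  let ?\<sigma> = "\<lambda>S d. if d \<in> S then f else g"
  let ?c = "\<lambda>S d. if d \<in> S then a else b"
  \<comment> \<open>Rewrites a term of the expansion as one product over \<open>D\<close>, the shape
    of a placement.\<close>
  have choose: "(\<Prod>d\<in>S. F d) * (\<Prod>d\<in>D - S. G d) = (\<Prod>d\<in>D. if d \<in> S then F d else G d)"
    if "S \<subseteq> D" for S and F G :: "'v \<times> 'v \<Rightarrow> ennreal"
  proof -
    have "D \<inter> {d. d \<in> S} = S" "D \<inter> - {d. d \<in> S} = D - S"
      using that by auto
    then show ?thesis
      by (simp only: prod.If_cases[OF finD])
  qed
  have meas: "?\<sigma> S d \<in> borel_measurable (P \<Otimes>\<^sub>M P)" for S and d :: "'v \<times> 'v"
    using f g by auto
  have "hom_integral P V D (\<lambda>_ z. a * f z + b * g z) =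
    (\<integral>\<^sup>+x. (\<Sum>S\<in>Pow D. \<Prod>d\<in>D. ?c S d * ?\<sigma> S d (x (fst d), x (snd d))) \<partial>Pi\<^sub>M V (\<lambda>_. P))"
    unfolding hom_integral_def
  proof (rule nn_integral_cong)
    fix x
    show "(\<Prod>d\<in>D. a * f (x (fst d), x (snd d)) + b * g (x (fst d), x (snd d))) =
      (\<Sum>S\<in>Pow D. \<Prod>d\<in>D. ?c S d * ?\<sigma> S d (x (fst d), x (snd d)))"
      by (subst prod_add[OF finD], rule sum.cong[OF refl], subst choose) (auto intro!: prod.cong)
  qed
  also have "\<dots> = (\<Sum>S\<in>Pow D. hom_integral P V D (\<lambda>d z. ?c S d * ?\<sigma> S d z))"
    unfolding hom_integral_def
    by (rule nn_integral_sum, rule measurable_edge_product[OF D]) (use f g in auto)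
  also have "\<dots> = (\<Sum>S\<in>Pow D. (\<Prod>d\<in>D. ?c S d) * hom_integral P V D (?\<sigma> S))"
    by (intro sum.cong refl hom_integral_cmult[OF D] meas)
  also have "\<dots> \<le> (\<Sum>S\<in>Pow D. (\<Prod>d\<in>D. ?c S d) * 1)"
  proof (intro sum_mono mult_left_mono)
    fix S
    show "hom_integral P V D (?\<sigma> S) \<le> 1"
      using hom_integral_two_functions_le[OF P fin D f g bound q const, of S] le_1
      by (meson max.boundedI order_trans)
  qed auto
  \<comment> \<open>The same expansion read backwards.\<close>
  also have "\<dots> = (\<Prod>d\<in>D. a + b)"
    by (subst prod_add[OF finD], rule sum.cong[OF refl], subst choose) auto
  finally show ?thesis by simp
qed

section \<open>Cut involutions of bipartite graphs\<close>

text \<open>The index set of the product in \<open>r_norm\<close>: orienting every edge from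
  \<open>A\<close> to \<open>B\<close> makes sense of a nonsymmetric kernel on it.\<close>

definition edge_pairs :: "'a set set \<Rightarrow> 'a set \<Rightarrow> 'a set \<Rightarrow> ('a \<times> 'a) set" where
  "edge_pairs E A B = {(a, b) \<in> A \<times> B. {a, b} \<in> E}"

lemma bij_betw_edge_pairs:
  assumes "bipartition V E A B"
  shows "bij_betw (\<lambda>(a, b). {a, b}) (edge_pairs E A B) E"
proof (rule bij_betw_imageI)
  show "inj_on (\<lambda>(a, b). {a, b}) (edge_pairs E A B)"
    using assms by (auto simp: inj_on_def edge_pairs_def bipartition_def doubleton_eq_iff)
  have "e \<in> (\<lambda>(a, b). {a, b}) ` edge_pairs E A B" if e: "e \<in> E" for e
  proof -
    obtain a b where "a \<in> A" "b \<in> B" "e = {a, b}"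
      using assms e unfolding bipartition_def by metis
    then show ?thesis
      using e by (intro image_eqI[of _ _ "(a, b)"]) (auto simp: edge_pairs_def)
  qed
  then show "(\<lambda>(a, b). {a, b}) ` edge_pairs E A B = E"
    by (auto simp: edge_pairs_def)
qed

lemma bipartition_edge:
  assumes "bipartition V E A B" "{u, v} \<in> E"
  shows "u \<in> A \<longleftrightarrow> v \<notin> A"
proof -
  obtain a b where "a \<in> A" "b \<in> B" "{u, v} = {a, b}"
    using assms unfolding bipartition_def by metis
  moreover have "A \<inter> B = {}"
    using assms unfolding bipartition_def by blast
  ultimately show "u \<in> A \<longleftrightarrow> v \<notin> A"
    unfolding doubleton_eq_iff by blast
qed

text \<open>Deleting nothing from a connected graph separates no two vertices. Hence every cut
  involution has a fixed vertex.\<close>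

lemma vertex_cut_nonempty:
  assumes "connected_graph V E" "vertex_cut V E F"
  shows "F \<noteq> {}"
  using assms unfolding connected_graph_def vertex_cut_def by auto

text \<open>The fixed vertex \<open>w\<close> keeps \<open>\<phi>\<close> from interchanging
  \<open>A\<close> and \<open>B\<close>: along a path from \<open>w\<close>, a vertex and its image
  change class together at every edge.\<close>

lemma graph_aut_mem_side_iff:
  assumes conn: "connected_graph V E" and bip: "bipartition V E A B"
    and \<phi>: "\<phi> \<in> graph_auts V E" and w: "w \<in> V" "\<phi> w = w" and v: "v \<in> V"
  shows "\<phi> v \<in> A \<longleftrightarrow> v \<in> A"
proof -
  have "(w, v) \<in> (adj_within E V)\<^sup>*"
    using conn w v unfolding connected_graph_def by blast
  then show ?thesis
  proof induction
    case base
    then show ?case using w by simp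
  next
    case (step y z)
    then have "y \<in> V" "z \<in> V" and yz: "{y, z} \<in> E"
      by (auto simp: adj_within_def)
    then have "{\<phi> y, \<phi> z} \<in> E"
      using \<phi> by (auto simp: graph_auts_def)
    then show ?case
      using bipartition_edge[OF bip] yz step.IH by blast
  qed
qed

lemma component_union_closed:
  assumes "\<C> \<subseteq> graph_components E U" "u \<in> \<Union>\<C>" "u \<in> U" "v \<in> U" "{u, v} \<in> E"
  shows "v \<in> \<Union>\<C>"
proof -
  obtain w where C: "{x. (w, x) \<in> (adj_within E U)\<^sup>*} \<in> \<C>" "(w, u) \<in> (adj_within E U)\<^sup>*"
    using assms(1,2) unfolding graph_components_def by blast
  have "(u, v) \<in> adj_within E U"
    using assms(3-5) by (simp add: adj_within_def)
  with C(2) have "(w, v) \<in> (adj_within E U)\<^sup>*"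
    by (rule rtrancl_into_rtrancl)
  then show ?thesis
    by (intro UnionI[OF C(1)]) simp
qed

text \<open>The fixed vertex supplied by the cut makes \<open>\<phi>\<close> preserve the
  orientation of edges. Since \<open>X\<close> is a union of components of the graph without the
  fixed set, no edge leads from \<open>X\<close> to \<open>Y\<close>.\<close>

lemma fold_symmetry_cut_involution:
  assumes conn: "connected_graph V E" and bip: "bipartition V E A B"
    and \<phi>: "cut_involution V E \<phi>" and sides: "fold_sides V E \<phi> X Y"
  shows "fold_symmetry V (edge_pairs E A B) \<phi> X Y"
proof -
  let ?D = "edge_pairs E A B"
  have aut: "\<phi> \<in> graph_auts V E" and inv: "\<forall>v\<in>V. \<phi> (\<phi> v) = v" and cut: "vertex_cut V E (fix_set V \<phi>)"
    using \<phi> by (simp_all add: cut_involution_def)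
  have XY: "X \<inter> Y = {}" "X \<union> Y = V - fix_set V \<phi>" and img: "\<phi> ` X = Y"
    and comp: "\<exists>\<C> \<subseteq> graph_components E (V - fix_set V \<phi>). X = \<Union>\<C>"
    using sides unfolding fold_sides_def by blast+
  obtain w where w: "w \<in> V" "\<phi> w = w"
    using vertex_cut_nonempty[OF conn cut] by (auto simp: fix_set_def)
  have img': "\<phi> ` Y = X"
  proof -
    have "(\<lambda>x. \<phi> (\<phi> x)) ` X = (\<lambda>x. x) ` X"
      by (rule image_cong) (use inv XY(2) in auto)
    then show ?thesis
      by (simp add: img[symmetric] image_image)
  qed
  have AB: "A \<inter> B = {}" "A \<union> B = V"
    using bip unfolding bipartition_def by blast+
  have maps: "\<phi> v \<in> V" if "v \<in> V" for v
    using aut that by (auto simp: graph_auts_def Bij_def bij_betw_def)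
  have D: "map_prod \<phi> \<phi> ` ?D \<subseteq> ?D"
  proof -
    have "\<phi> a \<in> A" "\<phi> b \<in> B" "{\<phi> a, \<phi> b} \<in> E" if "a \<in> A" "b \<in> B" "{a, b} \<in> E" for a b
    proof -
      have ab: "a \<in> V" "b \<in> V" "b \<notin> A"
        using that AB by blast+
      show "\<phi> a \<in> A"
        using graph_aut_mem_side_iff[OF conn bip aut w ab(1)] that by blast
      show "\<phi> b \<in> B"
        using graph_aut_mem_side_iff[OF conn bip aut w ab(2)] ab(3) maps[OF ab(2)] AB by blast
      show "{\<phi> a, \<phi> b} \<in> E"
        using aut ab that by (simp add: graph_auts_def)
    qed
    then show ?thesis
      by (auto simp: edge_pairs_def)
  qed
  have no_edge: "{u, v} \<notin> E" if "u \<in> X" "v \<in> Y" for u v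
  proof
    assume "{u, v} \<in> E"
    moreover obtain \<C> where "\<C> \<subseteq> graph_components E (V - fix_set V \<phi>)" "X = \<Union>\<C>"
      using comp by blast
    ultimately have "v \<in> X"
      using component_union_closed[of \<C> E _ u v] that XY(2) by blast
    with that XY(1) show False by blast
  qed
  then have "?D \<inter> (X \<times> Y \<union> Y \<times> X) = {}"
    by (auto simp: edge_pairs_def) (metis insert_commute)
  moreover have "\<forall>v\<in>V - (X \<union> Y). \<phi> v = v"
    using XY(2) by (auto simp: fix_set_def)
  moreover have "?D \<subseteq> V \<times> V"
    using AB by (auto simp: edge_pairs_def)
  moreover have "X \<union> Y \<subseteq> V"
    using XY(2) by blast
  ultimately show ?thesis
    unfolding fold_symmetry_def using XY(1) img img' inv D by (intro conjI)
qed

section \<open>The collapsing map of a percolating sequence\<close>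

lemma fold_monoid_edge:
  assumes "q \<in> fold_monoid V D" "d \<in> D"
  shows "map_prod q q d \<in> D"
  using assms
proof (induction arbitrary: d)
  case id
  then show ?case by (simp add: map_prod.id)
next
  case (fold q \<phi> X Y)
  then show ?case
    using fold.IH[OF fold_map_edge[OF fold.hyps(2) fold.prems]] by (cases d) simp
qed

text \<open>Each set of the sequence is the preimage of its predecessor, so the composed folding
  maps carry \<open>J i\<close> into \<open>J 0\<close>, and \<open>J N = E\<close>. One
  \<open>q\<close> must serve all bipartitions, because the existence of a bipartition is itself
  derived from \<open>q\<close> afterwards.\<close>

lemma percolating_sequence_fold:
  assumes conn: "connected_graph V E" and perc: "percolating_sequence V E L R J N"
  obtains e0 q where "e0 \<in> E" "\<forall>e\<in>E. q ` e = e0"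
    "\<forall>A B. bipartition V E A B \<longrightarrow> q \<in> fold_monoid V (edge_pairs E A B)"
proof -
  have J: "J 0 \<subseteq> E" "card (J 0) = 1" "J N = E" and step: "\<And>i. i < N \<Longrightarrow> folding_step V E L R (J i) (J (Suc i))"
    using perc unfolding percolating_sequence_def by blast+
  obtain e0 where e0: "J 0 = {e0}"
    using J(2) by (auto simp: card_1_singleton_iff)
  have "\<exists>q. (\<forall>e\<in>J i. q ` e \<in> J 0) \<and> (\<forall>A B. bipartition V E A B \<longrightarrow> q \<in> fold_monoid V (edge_pairs E A B))"
    if "i \<le> N" for i
    using that
  proof (induction i)
    case 0
    show ?case
      by (rule exI[of _ id]) (simp add: fold_monoid.id[unfolded id_def])
  next
    case (Suc i)
    then obtain q where q: "\<forall>e\<in>J i. q ` e \<in> J 0"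
      "\<forall>A B. bipartition V E A B \<longrightarrow> q \<in> fold_monoid V (edge_pairs E A B)"
      by auto
    obtain \<phi> where \<phi>: "cut_involution V E \<phi>" "fold_sides V E \<phi> (L \<phi>) (R \<phi>)"
      and J': "J (Suc i) = fold_pullback E (fold_map \<phi> (R \<phi>)) (J i) \<or>
        J (Suc i) = fold_pullback E (fold_map \<phi> (L \<phi>)) (J i)"
      using step[of i] Suc.prems unfolding folding_step_def by auto
    \<comment> \<open>Treats left and right folding at once; \<open>fold_symmetry_commute\<close>
      covers the exchanged sides.\<close>
    then obtain S where S: "S = R \<phi> \<or> S = L \<phi>" "J (Suc i) = fold_pullback E (fold_map \<phi> S) (J i)"
      by blast
    have "q \<circ> fold_map \<phi> S \<in> fold_monoid V (edge_pairs E A B)" if "bipartition V E A B" for A B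
    proof -
      have "fold_symmetry V (edge_pairs E A B) \<phi> (L \<phi>) (R \<phi>)"
        by (rule fold_symmetry_cut_involution[OF conn that \<phi>])
      then show ?thesis
        using S(1) q(2) that by (metis fold_monoid.fold fold_symmetry_commute)
    qed
    moreover have "\<forall>e\<in>J (Suc i). (q \<circ> fold_map \<phi> S) ` e \<in> J 0"
    proof
      fix e assume "e \<in> J (Suc i)"
      then have "q ` (fold_map \<phi> S ` e) \<in> J 0"
        using q(1) unfolding S(2) fold_pullback_def by blast
      then show "(q \<circ> fold_map \<phi> S) ` e \<in> J 0"
        by (simp only: image_comp)
    qed
    ultimately show ?case by blast
  qed
  from this[OF order_refl] obtain q where "\<forall>e\<in>E. q ` e = e0"
    "\<forall>A B. bipartition V E A B \<longrightarrow> q \<in> fold_monoid V (edge_pairs E A B)"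
    unfolding J(3) e0 by auto
  moreover have "e0 \<in> E"
    using J(1) e0 by simp
  ultimately show ?thesis
    by (intro that[of e0 q]) simp_all
qed

text \<open>The two ends of an edge are mapped onto the two distinct ends of \<open>e0\<close>, so
  \<open>q\<close> is a proper colouring of the edges with two colours at their ends.\<close>

lemma bipartition_of_collapse:
  assumes G: "simple_graph V E" and e0: "e0 \<in> E" and q: "\<And>e. e \<in> E \<Longrightarrow> q ` e = e0"
  shows "\<exists>A B. bipartition V E A B"
proof -
  obtain a0 b0 where ab: "e0 = {a0, b0}" "a0 \<noteq> b0"
    using G e0 unfolding simple_graph_def by (metis card_2_iff)
  have "\<exists>a\<in>{v \<in> V. q v = a0}. \<exists>b\<in>{v \<in> V. q v \<noteq> a0}. e = {a, b}" if "e \<in> E" for e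
  proof -
    have "card e = 2" "e \<subseteq> V"
      using G that unfolding simple_graph_def by blast+
    then obtain u v where uv: "e = {u, v}" "u \<in> V" "v \<in> V"
      by (auto simp: card_2_iff)
    have "{q u, q v} = {a0, b0}"
      using q[OF that] ab uv by simp
    then have "q u = a0 \<and> q v \<noteq> a0 \<or> q v = a0 \<and> q u \<noteq> a0"
      using ab(2) by (auto simp: doubleton_eq_iff)
    then show ?thesis
      using uv by (auto simp: insert_commute)
  qed
  \<comment> \<open>The second class is the complement of the first rather than the fibre over
    \<open>b0\<close>: the classes must cover \<open>V\<close>, and nothing is known about
    \<open>q\<close> at isolated vertices.\<close>
  then have "bipartition V E {v \<in> V. q v = a0} {v \<in> V. q v \<noteq> a0}"
    unfolding bipartition_def by auto
  then show ?thesis by blast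
qed

text \<open>As sets, all edges collapse to \<open>e0\<close>. Maps in \<open>fold_monoid\<close>
  send \<open>edge_pairs\<close> into itself, so no edge is reversed and the ordered pairs collapse
  as well.\<close>

lemma fold_collapse_edge_pairs:
  assumes bip: "bipartition V E A B" and e0: "e0 \<in> E" and q: "\<And>e. e \<in> E \<Longrightarrow> q ` e = e0"
    and fold: "q \<in> fold_monoid V (edge_pairs E A B)"
  obtains d0 where "d0 \<in> edge_pairs E A B" "\<forall>d\<in>edge_pairs E A B. map_prod q q d = d0"
proof -
  note bij = bij_betw_edge_pairs[OF bip]
  have "e0 \<in> (\<lambda>(a, b). {a, b}) ` edge_pairs E A B"
    using e0 by (simp only: bij_betw_imp_surj_on[OF bij])
  then obtain d0 where d0: "d0 \<in> edge_pairs E A B" "(\<lambda>(a, b). {a, b}) d0 = e0"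
    by (elim imageE) (rule that, simp_all only:)
  have "map_prod q q d = d0" if d: "d \<in> edge_pairs E A B" for d
  proof -
    obtain a b where ab: "d = (a, b)" "{a, b} \<in> E"
      using d unfolding edge_pairs_def by blast
    have "(\<lambda>(a, b). {a, b}) (map_prod q q d) = e0"
      using q[OF ab(2)] ab(1) by simp
    then show ?thesis
      using inj_onD[OF bij_betw_imp_inj_on[OF bij] _ fold_monoid_edge[OF fold d] d0(1)] d0(2) by simp
  qed
  then show ?thesis
    by (intro that[OF d0(1)] ballI)
qed

section \<open>The unit square\<close>

text \<open>Two different coordinates are independent with law \<open>P\<close>; it suffices to
  compare rectangles.\<close>

lemma distr_PiM_pair:
  assumes P: "prob_space P" and V: "finite V" "u \<in> V" "v \<in> V" "u \<noteq> v"
  shows "distr (Pi\<^sub>M V (\<lambda>_. P)) (P \<Otimes>\<^sub>M P) (\<lambda>x. (x u, x v)) = P \<Otimes>\<^sub>M P"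
proof (rule pair_measure_eqI[symmetric])
  interpret P: prob_space P by fact
  interpret product_sigma_finite "\<lambda>_. P"
    by unfold_locales
  show "sigma_finite_measure P" "sigma_finite_measure P"
    by unfold_locales
  show "sets (P \<Otimes>\<^sub>M P) = sets (distr (Pi\<^sub>M V (\<lambda>_. P)) (P \<Otimes>\<^sub>M P) (\<lambda>x. (x u, x v)))"
    by simp
  fix A B assume A: "A \<in> sets P" and B: "B \<in> sets P"
  have m: "(\<lambda>x. (x u, x v)) \<in> Pi\<^sub>M V (\<lambda>_. P) \<rightarrow>\<^sub>M P \<Otimes>\<^sub>M P"
    using V by (intro measurable_Pair measurable_component_singleton)
  let ?X = "\<lambda>i. if i = u then A else if i = v then B else space P"
  have "(\<lambda>x. (x u, x v)) -` (A \<times> B) \<inter> space (Pi\<^sub>M V (\<lambda>_. P)) = Pi\<^sub>E V ?X"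
  proof (intro equalityI subsetI)
    fix x assume "x \<in> (\<lambda>x. (x u, x v)) -` (A \<times> B) \<inter> space (Pi\<^sub>M V (\<lambda>_. P))"
    then show "x \<in> Pi\<^sub>E V ?X"
      by (auto simp: space_PiM PiE_iff)
  next
    fix x assume x: "x \<in> Pi\<^sub>E V ?X"
    then have "x u \<in> A" "x v \<in> B"
      using PiE_mem[OF x V(2)] PiE_mem[OF x V(3)] V(4) by simp_all
    moreover have "?X i \<subseteq> space P" for i
      using sets.sets_into_space[OF A] sets.sets_into_space[OF B] by simp
    then have "x \<in> (\<Pi>\<^sub>E i\<in>V. space P)"
      using x by (rule subsetD[OF PiE_mono])
    ultimately show "x \<in> (\<lambda>x. (x u, x v)) -` (A \<times> B) \<inter> space (Pi\<^sub>M V (\<lambda>_. P))"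
      by (simp add: space_PiM)
  qed
  then have "emeasure (distr (Pi\<^sub>M V (\<lambda>_. P)) (P \<Otimes>\<^sub>M P) (\<lambda>x. (x u, x v))) (A \<times> B) =
      (\<Prod>i\<in>V. emeasure P (?X i))"
    using A B V by (subst emeasure_distr[OF m]) (auto simp: emeasure_PiM)
  also have "\<dots> = (\<Prod>i\<in>insert u (insert v (V - {u, v})). emeasure P (?X i))"
    using V by (intro prod.cong) auto
  also have "\<dots> = emeasure P A * (emeasure P B * (\<Prod>i\<in>V - {u, v}. emeasure P (?X i)))"
    using V by simp
  also have "(\<Prod>i\<in>V - {u, v}. emeasure P (?X i)) = 1"
    by (intro prod.neutral) (auto simp: P.emeasure_space_1)
  finally show "emeasure P A * emeasure P B =
      emeasure (distr (Pi\<^sub>M V (\<lambda>_. P)) (P \<Otimes>\<^sub>M P) (\<lambda>x. (x u, x v))) (A \<times> B)"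
    by simp
qed

text \<open>Pulls null sets of the square back to null sets of the cube. Distinct vertices matter:
  on a loop the argument would stay on the diagonal, which may itself be null.\<close>

lemma AE_PiM_pair:
  assumes "prob_space P" "finite V" "u \<in> V" "v \<in> V" "u \<noteq> v" and "AE z in P \<Otimes>\<^sub>M P. Q z"
  shows "AE x in Pi\<^sub>M V (\<lambda>_. P). Q (x u, x v)"
proof -
  have "(\<lambda>x. (x u, x v)) \<in> Pi\<^sub>M V (\<lambda>_. P) \<rightarrow>\<^sub>M P \<Otimes>\<^sub>M P"
    using assms(3,4) by (intro measurable_Pair measurable_component_singleton)
  from AE_distrD[OF this, of Q] show ?thesis
    using assms(6) by (simp only: distr_PiM_pair[OF assms(1-5)])
qed

text \<open>The other factors are 1 and the remaining coordinates integrate out. Membership in a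
  singleton, instead of an equation, matches the set \<open>S\<close> of
  \<open>hom_integral_two_functions_le\<close>.\<close>

lemma hom_integral_single_edge:
  assumes P: "prob_space P" and fin: "finite V" "finite D" and d: "(u, v) \<in> D" "u \<in> V" "v \<in> V" "u \<noteq> v"
    and f: "f \<in> borel_measurable (P \<Otimes>\<^sub>M P)"
  shows "hom_integral P V D (\<lambda>d. if d \<in> {(u, v)} then f else (\<lambda>_. 1)) = (\<integral>\<^sup>+z. f z \<partial>(P \<Otimes>\<^sub>M P))"
proof -
  have m: "(\<lambda>x. (x u, x v)) \<in> Pi\<^sub>M V (\<lambda>_. P) \<rightarrow>\<^sub>M P \<Otimes>\<^sub>M P"
    using d by (intro measurable_Pair measurable_component_singleton)
  have "hom_integral P V D (\<lambda>d. if d \<in> {(u, v)} then f else (\<lambda>_. 1)) =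
      (\<integral>\<^sup>+x. f (x u, x v) \<partial>Pi\<^sub>M V (\<lambda>_. P))"
    unfolding hom_integral_def
  proof (rule nn_integral_cong)
    fix x
    have "(\<Prod>d\<in>D. (if d \<in> {(u, v)} then f else (\<lambda>_. 1)) (x (fst d), x (snd d))) =
      (\<Prod>d\<in>D. if d = (u, v) then f (x u, x v) else 1)"
      by (intro prod.cong) auto
    then show "(\<Prod>d\<in>D. (if d \<in> {(u, v)} then f else (\<lambda>_. 1)) (x (fst d), x (snd d))) = f (x u, x v)"
      using fin d by (simp add: prod.delta)
  qed
  also have "\<dots> = (\<integral>\<^sup>+z. f z \<partial>distr (Pi\<^sub>M V (\<lambda>_. P)) (P \<Otimes>\<^sub>M P) (\<lambda>x. (x u, x v)))"
    using f by (subst nn_integral_distr[OF m]) auto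
  finally show ?thesis
    by (simp add: distr_PiM_pair[OF P fin(1) d(2-4)])
qed

section \<open>Lebesgue measure on the unit square and Borel representatives\<close>

abbreviation unit_lborel :: "real measure" where
  "unit_lborel \<equiv> restrict_space lborel {0..1}"

lemma prob_space_unit_lborel: "prob_space unit_lborel"
  by (rule prob_spaceI) (simp add: emeasure_restrict_space)

lemma pair_unit_lborel:
  "unit_lborel \<Otimes>\<^sub>M unit_lborel = restrict_space lborel ({0..1} \<times> {0..1})"
proof (rule pair_measure_eqI)
  interpret prob_space unit_lborel by (rule prob_space_unit_lborel)
  show "sigma_finite_measure unit_lborel" "sigma_finite_measure unit_lborel"
    by unfold_locales
  have S: "({0..1::real} \<times> {0..1::real}) \<in> sets borel"
    by (intro borel_closed closed_Times) auto
  have Times: "A \<times> B \<in> sets borel" if "A \<in> sets borel" "B \<in> sets borel" for A B :: "real set"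
    using that by (metis borel_prod pair_measureI)
  show "sets (unit_lborel \<Otimes>\<^sub>M unit_lborel) = sets (restrict_space lborel ({0..1} \<times> {0..1}))"
  proof
    show "sets (unit_lborel \<Otimes>\<^sub>M unit_lborel) \<subseteq> sets (restrict_space lborel ({0..1} \<times> {0..1}))"
      using S Times by (intro sets_pair_in_sets) (auto simp: sets_restrict_space_iff)
    \<comment> \<open>The inclusion of the square into the plane is measurable, and a Borel subset
      of the square is its own preimage.\<close>
    have id: "(\<lambda>z. z) \<in> unit_lborel \<Otimes>\<^sub>M unit_lborel \<rightarrow>\<^sub>M borel \<Otimes>\<^sub>M borel"
    proof (rule measurable_pair)
      have emb: "(\<lambda>x. x) \<in> unit_lborel \<rightarrow>\<^sub>M borel"
        by (rule measurable_restrict_space1) simp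
      show "fst \<circ> (\<lambda>z. z) \<in> unit_lborel \<Otimes>\<^sub>M unit_lborel \<rightarrow>\<^sub>M borel"
        using measurable_compose[OF measurable_fst emb] by (simp add: comp_def)
      show "snd \<circ> (\<lambda>z. z) \<in> unit_lborel \<Otimes>\<^sub>M unit_lborel \<rightarrow>\<^sub>M borel"
        using measurable_compose[OF measurable_snd emb] by (simp add: comp_def)
    qed
    show "sets (restrict_space lborel ({0..1} \<times> {0..1})) \<subseteq> sets (unit_lborel \<Otimes>\<^sub>M unit_lborel)"
    proof
      fix X assume "X \<in> sets (restrict_space lborel ({0..1::real} \<times> {0..1::real}))"
      then have "X \<in> sets borel" "X \<subseteq> {0..1} \<times> {0..1}"
        using S by (simp_all add: sets_restrict_space_iff)
      then have "X \<in> sets (borel \<Otimes>\<^sub>M borel)" "X \<subseteq> {0..1} \<times> {0..1}"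
        by (simp_all only: borel_prod)
      then show "X \<in> sets (unit_lborel \<Otimes>\<^sub>M unit_lborel)"
        using measurable_sets[OF id, of X] by (simp add: space_pair_measure space_restrict_space Int_absorb2)
    qed
  qed
  fix A B :: "real set" assume A: "A \<in> sets unit_lborel" and B: "B \<in> sets unit_lborel"
  then have AB: "A \<in> sets borel" "A \<subseteq> {0..1}" "B \<in> sets borel" "B \<subseteq> {0..1}"
    by (simp_all add: sets_restrict_space_iff)
  have "emeasure (restrict_space lborel ({0..1} \<times> {0..1})) (A \<times> B) = emeasure (lborel \<Otimes>\<^sub>M lborel) (A \<times> B)"
    using AB S by (subst emeasure_restrict_space) (auto simp: lborel_prod)
  also have "\<dots> = emeasure lborel A * emeasure lborel B"
    using AB by (intro lborel.emeasure_pair_measure_Times) auto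
  finally show "emeasure unit_lborel A * emeasure unit_lborel B =
      emeasure (restrict_space lborel ({0..1} \<times> {0..1})) (A \<times> B)"
    using AB by (simp add: emeasure_restrict_space)
qed

lemma AE_unit_square_iff:
  "(AE z in lebesgue_on ({0..1::real} \<times> {0..1::real}). Q z) \<longleftrightarrow> (AE z in unit_lborel \<Otimes>\<^sub>M unit_lborel. Q z)"
proof -
  have S: "({0..1::real} \<times> {0..1::real}) \<in> sets borel"
    by (intro borel_closed closed_Times) auto
  then show ?thesis
    unfolding pair_unit_lborel by (simp add: AE_restrict_space_iff AE_completion_iff)
qed

text \<open>A Lebesgue measurable function agrees almost everywhere with a Borel one, which brings
  it within reach of Tonelli on the uncompleted product. The bound is arranged at every point
  because the later estimates are pointwise.\<close>

lemma bounded_measurable_borel_representative: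
  assumes "f \<in> bounded_measurable"
  obtains g C where "g \<in> borel_measurable (unit_lborel \<Otimes>\<^sub>M unit_lborel)" "\<forall>z. \<bar>g z\<bar> \<le> C"
    "AE z in unit_lborel \<Otimes>\<^sub>M unit_lborel. f z = g z"
proof -
  let ?S = "{0..1::real} \<times> {0..1::real}"
  have S: "?S \<in> sets borel"
    by (intro borel_closed closed_Times) auto
  obtain C where C: "\<And>z. z \<in> ?S \<Longrightarrow> \<bar>f z\<bar> \<le> C"
    using assms unfolding bounded_measurable_def bounded_iff by auto
  have "(\<lambda>z. if z \<in> ?S then f z else 0) \<in> borel_measurable lebesgue"
    using assms S by (subst borel_measurable_if) (auto simp: bounded_measurable_def)
  then obtain g where g: "g \<in> borel_measurable lborel" "AE z in lborel. (if z \<in> ?S then f z else 0) = g z"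
    using completion_ex_borel_measurable_real by blast
  show ?thesis
  proof (rule that)
    \<comment> \<open>Truncation enforces the bound without disturbing \<open>g\<close> where it
      equals \<open>f\<close> on the square; \<open>\<bar>C\<bar>\<close> keeps the interval
      nonempty whatever the sign of \<open>C\<close>.\<close>
    let ?g = "\<lambda>z. max (- \<bar>C\<bar>) (min \<bar>C\<bar> (g z))"
    show "?g \<in> borel_measurable (unit_lborel \<Otimes>\<^sub>M unit_lborel)"
      unfolding pair_unit_lborel by (rule measurable_restrict_space1) (use g(1) in measurable)
    show "\<forall>z. \<bar>?g z\<bar> \<le> \<bar>C\<bar>"
      by (intro allI) linarith
    have "AE z in lborel. z \<in> ?S \<longrightarrow> f z = ?g z"
      using g(2)
    proof eventually_elim
      case (elim z)
      show ?case
      proof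
        assume z: "z \<in> ?S"
        then have "f z = g z" using elim by simp
        then show "f z = ?g z" using C[OF z] by linarith
      qed
    qed
    then show "AE z in unit_lborel \<Otimes>\<^sub>M unit_lborel. f z = ?g z"
      unfolding pair_unit_lborel using S by (simp add: AE_restrict_space_iff)
  qed
qed

text \<open>Preimages under \<open>f\<close> and \<open>g\<close> differ only within a null set, and
  the completion contains all such sets.\<close>

lemma measurable_completion_AE_eq:
  assumes g: "g \<in> M \<rightarrow>\<^sub>M N" and eq: "AE x in M. f x = g x"
    and f: "\<And>x. x \<in> space M \<Longrightarrow> f x \<in> space N"
  shows "f \<in> completion M \<rightarrow>\<^sub>M N"
proof (rule measurableI)
  show "f x \<in> space N" if "x \<in> space (completion M)" for x
    using that f by simp
  fix A assume "A \<in> sets N"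
  then have A: "g -` A \<inter> space M \<in> sets (completion M)"
    using g by (auto intro: measurable_sets)
  have "AE x in completion M. x \<in> g -` A \<inter> space M \<longleftrightarrow> x \<in> f -` A \<inter> space (completion M)"
    using AE_completion[OF eq] by eventually_elim auto
  then show "f -` A \<inter> space (completion M) \<in> sets (completion M)"
    using A by (rule completion.in_sets_AE) auto
qed

definition borel_norm :: "'a set \<Rightarrow> ('a \<times> 'a) set \<Rightarrow> (real \<times> real \<Rightarrow> real) \<Rightarrow> real" where
  "borel_norm V D g =
     enn2real (hom_integral unit_lborel V D (\<lambda>_ z. ennreal \<bar>g z\<bar>)) powr (1 / real (card D))"

text \<open>Passing to \<open>g\<close> alters each of finitely many factors only on a null set of
  the cube. This gives both the measurability of the original integrand in the completion and the
  value of its integral.\<close>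

lemma r_norm_eq_borel_norm:
  assumes V: "finite V" and bip: "bipartition V E A B"
    and g: "g \<in> borel_measurable (unit_lborel \<Otimes>\<^sub>M unit_lborel)"
    and eq: "AE z in unit_lborel \<Otimes>\<^sub>M unit_lborel. f z = g z"
  shows "r_norm V E A B f = borel_norm V (edge_pairs E A B) g"
proof -
  let ?D = "edge_pairs E A B" and ?P = unit_lborel
  let ?M = "Pi\<^sub>M V (\<lambda>_. unit_lborel)"
  let ?F = "\<lambda>f x. \<Prod>(a, b)\<in>?D. \<bar>f (x a, x b)\<bar> :: real"
  have D: "a \<in> V" "b \<in> V" "a \<noteq> b" if "(a, b) \<in> ?D" for a b
    using that bip by (auto simp: edge_pairs_def bipartition_def)
  have finD: "finite ?D"
    using V D by (auto intro: finite_subset[of _ "V \<times> V"])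
  have card: "card ?D = card E"
    using bij_betw_same_card[OF bij_betw_edge_pairs[OF bip]] .
  have mg: "?F g \<in> borel_measurable ?M"
  proof (rule borel_measurable_prod)
    fix d assume d: "d \<in> ?D"
    then have "(\<lambda>x. g (x (fst d), x (snd d))) \<in> borel_measurable ?M"
      using D[of "fst d" "snd d"]
      by (intro measurable_compose[OF _ g] measurable_Pair measurable_component_singleton) auto
    then show "(\<lambda>x. case d of (a, b) \<Rightarrow> \<bar>g (x a, x b)\<bar>) \<in> borel_measurable ?M"
      by (simp add: case_prod_unfold)
  qed
  have "AE x in ?M. \<forall>d\<in>?D. f (x (fst d), x (snd d)) = g (x (fst d), x (snd d))"
  proof (rule AE_finite_allI[OF finD])
    fix d assume "d \<in> ?D"
    then show "AE x in ?M. f (x (fst d), x (snd d)) = g (x (fst d), x (snd d))"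
      using D[of "fst d" "snd d"] by (intro AE_PiM_pair[OF prob_space_unit_lborel V _ _ _ eq]) auto
  qed
  then have AE: "AE x in ?M. ?F f x = ?F g x"
    by eventually_elim (auto intro!: prod.cong)
  have mf: "?F f \<in> borel_measurable (completion ?M)"
    by (rule measurable_completion_AE_eq[OF mg AE]) simp
  have "(LINT x|cube_measure V. ?F f x) = (LINT x|completion ?M. ?F g x)"
    unfolding cube_measure_def
    by (rule integral_cong_AE[OF mf measurable_completion[OF mg] AE_completion[OF AE]])
  also have "\<dots> = (LINT x|?M. ?F g x)"
    by (rule integral_completion[OF mg])
  also have "\<dots> = enn2real (\<integral>\<^sup>+x. ennreal (?F g x) \<partial>?M)"
    by (rule integral_eq_nn_integral[OF mg]) (auto intro!: prod_nonneg)
  also have "(\<integral>\<^sup>+x. ennreal (?F g x) \<partial>?M) = hom_integral ?P V ?D (\<lambda>_ z. ennreal \<bar>g z\<bar>)"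
    unfolding hom_integral_def
    by (intro nn_integral_cong) (simp add: case_prod_unfold prod_ennreal)
  finally show ?thesis
    unfolding r_norm_def borel_norm_def card edge_pairs_def[symmetric] by (simp only:)
qed

section \<open>Norm axioms\<close>

text \<open>Trades the root for a comparison of integrals. The bound on \<open>g\<close> keeps the
  integral finite, so \<open>enn2real\<close>, which sends infinity to 0, loses nothing.\<close>

lemma borel_norm_le_iff:
  assumes D: "D \<subseteq> V \<times> V" "finite D" "D \<noteq> {}" and g: "\<And>z. \<bar>g z\<bar> \<le> C" and x: "0 \<le> x"
  shows "borel_norm V D g \<le> x \<longleftrightarrow> hom_integral unit_lborel V D (\<lambda>_ z. ennreal \<bar>g z\<bar>) \<le> ennreal (x ^ card D)"
proof -
  let ?H = "hom_integral unit_lborel V D (\<lambda>_ z. ennreal \<bar>g z\<bar>)"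
  have n: "card D > 0"
    using D by (simp add: card_gt_0_iff)
  have "?H \<le> hom_integral unit_lborel V D (\<lambda>_ _. ennreal C)"
    by (rule hom_integral_mono) (simp add: g ennreal_leI)
  also have "\<dots> < \<infinity>"
    by (simp add: hom_integral_const[OF prob_space_unit_lborel] power_less_top_ennreal)
  finally obtain r where r: "?H = ennreal r" "0 \<le> r"
    by (cases ?H) auto
  have x_root: "x = (x ^ card D) powr (1 / real (card D))"
    using x n by (cases "x = 0") (auto simp: powr_realpow[symmetric] powr_powr)
  have "r powr (1 / real (card D)) \<le> x \<longleftrightarrow> r \<le> x ^ card D"
  proof
    assume "r powr (1 / real (card D)) \<le> x"
    then have "r powr (1 / real (card D)) \<le> (x ^ card D) powr (1 / real (card D))"
      by (simp only: x_root[symmetric])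
    then show "r \<le> x ^ card D"
      using powr_less_mono2[of "1 / real (card D)" "x ^ card D" r] x n by (simp add: not_less[symmetric]) fastforce
  next
    assume "r \<le> x ^ card D"
    then have "r powr (1 / real (card D)) \<le> (x ^ card D) powr (1 / real (card D))"
      using r(2) by (intro powr_mono2) auto
    then show "r powr (1 / real (card D)) \<le> x"
      by (simp only: x_root[symmetric])
  qed
  then show ?thesis
    using r x by (simp add: borel_norm_def)
qed

lemma borel_norm_cmult:
  assumes D: "D \<subseteq> V \<times> V" "finite D" "D \<noteq> {}" and g: "g \<in> borel_measurable (unit_lborel \<Otimes>\<^sub>M unit_lborel)"
  shows "borel_norm V D (\<lambda>z. c * g z) = \<bar>c\<bar> * borel_norm V D g"
proof -
  have n: "card D > 0"
    using D by (simp add: card_gt_0_iff)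
  have "(\<lambda>z. ennreal \<bar>c * g z\<bar>) = (\<lambda>z. ennreal \<bar>c\<bar> * ennreal \<bar>g z\<bar>)"
    by (simp add: abs_mult ennreal_mult)
  then have "hom_integral unit_lborel V D (\<lambda>_ z. ennreal \<bar>c * g z\<bar>) =
    ennreal (\<bar>c\<bar> ^ card D) * hom_integral unit_lborel V D (\<lambda>_ z. ennreal \<bar>g z\<bar>)"
    using hom_integral_cmult[OF D(1), of "\<lambda>_ z. ennreal \<bar>g z\<bar>" unit_lborel "\<lambda>_. ennreal \<bar>c\<bar>"] g
    by (simp add: ennreal_power)
  moreover have "(\<bar>c\<bar> ^ card D) powr (1 / real (card D)) = \<bar>c\<bar>"
    using n by (cases "c = 0") (auto simp: powr_realpow[symmetric] powr_powr)
  ultimately show ?thesis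
    by (simp add: borel_norm_def enn2real_mult powr_mult)
qed

text \<open>Apply \<open>hom_integral_add_le\<close> with weights \<open>a\<close> and
  \<open>b\<close> slightly above the two norms to the absolute values of \<open>f\<close> and
  \<open>g\<close> divided by these weights.\<close>

lemma borel_norm_triangle:
  assumes V: "finite V" and D: "D \<subseteq> V \<times> V" "D \<noteq> {}"
    and q: "q \<in> fold_monoid V D" "\<And>d. d \<in> D \<Longrightarrow> map_prod q q d = d0"
    and f: "f \<in> borel_measurable (unit_lborel \<Otimes>\<^sub>M unit_lborel)" "\<And>z. \<bar>f z\<bar> \<le> Cf"
    and g: "g \<in> borel_measurable (unit_lborel \<Otimes>\<^sub>M unit_lborel)" "\<And>z. \<bar>g z\<bar> \<le> Cg"
  shows "borel_norm V D (\<lambda>z. f z + g z) \<le> borel_norm V D f + borel_norm V D g"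
proof (rule field_le_epsilon)
  fix e :: real assume e: "0 < e"
  \<comment> \<open>The slack \<open>e / 2\<close> keeps \<open>a\<close> and \<open>b\<close>
    positive even when a norm vanishes, so that division by them is possible.\<close>
  define a where "a = borel_norm V D f + e / 2"
  define b where "b = borel_norm V D g + e / 2"
  have pos: "0 < a" "0 < b"
    using e by (auto simp: a_def b_def borel_norm_def intro: add_nonneg_pos)
  have finD: "finite D"
    using D V by (meson finite_SigmaI finite_subset)
  let ?H = "\<lambda>h. hom_integral unit_lborel V D (\<lambda>_ z. ennreal (h z))"
  have scaled_le: "?H (\<lambda>z. \<bar>h z\<bar> / c) \<le> 1"
    if h: "h \<in> borel_measurable (unit_lborel \<Otimes>\<^sub>M unit_lborel)" "\<And>z. \<bar>h z\<bar> \<le> C"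
      and c: "0 < c" "borel_norm V D h \<le> c" for h C c
  proof -
    have "(\<lambda>z. ennreal (\<bar>h z\<bar> / c)) = (\<lambda>z. ennreal (1 / c) * ennreal \<bar>h z\<bar>)"
      using c by (simp add: ennreal_mult[symmetric])
    then have "?H (\<lambda>z. \<bar>h z\<bar> / c) = ennreal ((1 / c) ^ card D) * ?H (\<lambda>z. \<bar>h z\<bar>)"
      using hom_integral_cmult[OF D(1), of "\<lambda>_ z. ennreal \<bar>h z\<bar>" unit_lborel "\<lambda>_. ennreal (1 / c)"] h c
      by (simp add: ennreal_power)
    also have "\<dots> \<le> ennreal ((1 / c) ^ card D) * ennreal (c ^ card D)"
      using c borel_norm_le_iff[OF D(1) finD D(2) h(2), of c] by (intro mult_left_mono) auto
    also have "\<dots> = 1"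
      using c by (simp add: ennreal_mult[symmetric] power_mult_distrib[symmetric] power_one_over)
    finally show ?thesis .
  qed
  let ?C = "max (Cf / a) (Cg / b)"
  have "hom_integral unit_lborel V D (\<lambda>_ z. ennreal a * ennreal (\<bar>f z\<bar> / a) + ennreal b * ennreal (\<bar>g z\<bar> / b))
      \<le> (ennreal a + ennreal b) ^ card D"
  proof (rule hom_integral_add_le[OF prob_space_unit_lborel V D(1), where C="ennreal ?C" and q=q and ?d0.0=d0])
    show "(\<lambda>z. ennreal (\<bar>f z\<bar> / a)) \<in> borel_measurable (unit_lborel \<Otimes>\<^sub>M unit_lborel)"
      "(\<lambda>z. ennreal (\<bar>g z\<bar> / b)) \<in> borel_measurable (unit_lborel \<Otimes>\<^sub>M unit_lborel)"
      using f(1) g(1) by measurable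
    show "ennreal (\<bar>f z\<bar> / a) \<le> ennreal ?C" for z
      using f(2) pos by (intro ennreal_leI max.coboundedI1 divide_right_mono) auto
    show "ennreal (\<bar>g z\<bar> / b) \<le> ennreal ?C" for z
      using g(2) pos by (intro ennreal_leI max.coboundedI2 divide_right_mono) auto
    show "?H (\<lambda>z. \<bar>f z\<bar> / a) \<le> 1" "?H (\<lambda>z. \<bar>g z\<bar> / b) \<le> 1"
      using e pos by (auto intro!: scaled_le f g simp: a_def b_def)
  qed (use q in auto)
  also have "(ennreal a + ennreal b) ^ card D = ennreal ((a + b) ^ card D)"
    using pos by (simp add: ennreal_plus[symmetric] ennreal_power del: ennreal_plus)
  \<comment> \<open>The weights cancel the normalisation.\<close>
  also have "(\<lambda>(_::'a \<times> 'a) z. ennreal a * ennreal (\<bar>f z\<bar> / a) + ennreal b * ennreal (\<bar>g z\<bar> / b)) =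
      (\<lambda>_ z. ennreal (\<bar>f z\<bar> + \<bar>g z\<bar>))"
    using pos by (simp add: ennreal_mult[symmetric])
  finally have "?H (\<lambda>z. \<bar>f z\<bar> + \<bar>g z\<bar>) \<le> ennreal ((a + b) ^ card D)" .
  moreover have "?H (\<lambda>z. \<bar>f z + g z\<bar>) \<le> ?H (\<lambda>z. \<bar>f z\<bar> + \<bar>g z\<bar>)"
    by (rule hom_integral_mono) (intro ennreal_leI abs_triangle_ineq)
  ultimately have H: "?H (\<lambda>z. \<bar>f z + g z\<bar>) \<le> ennreal ((a + b) ^ card D)"
    by (rule order_trans[rotated])
  have bound: "\<bar>f z + g z\<bar> \<le> Cf + Cg" for z
    using f(2)[of z] g(2)[of z] by linarith
  have "borel_norm V D (\<lambda>z. f z + g z) \<le> a + b"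
    using borel_norm_le_iff[OF D(1) finD D(2), of "\<lambda>z. f z + g z", OF bound, of "a + b"] H pos by simp
  then show "borel_norm V D (\<lambda>z. f z + g z) \<le> borel_norm V D f + borel_norm V D g + e"
    by (simp add: a_def b_def)
qed

text \<open>If the norm vanishes, testing \<open>f\<close> on the single pair \<open>d0\<close>
  forces its absolute value to have integral 0. Conversely, one factor that vanishes almost
  everywhere kills the whole product.\<close>

lemma borel_norm_eq_0_iff:
  assumes V: "finite V" and D: "D \<subseteq> V \<times> V" "d0 \<in> D" and loopless: "\<And>u v. (u, v) \<in> D \<Longrightarrow> u \<noteq> v"
    and q: "q \<in> fold_monoid V D" "\<And>d. d \<in> D \<Longrightarrow> map_prod q q d = d0"
    and f: "f \<in> borel_measurable (unit_lborel \<Otimes>\<^sub>M unit_lborel)" "\<And>z. \<bar>f z\<bar> \<le> C"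
  shows "borel_norm V D f = 0 \<longleftrightarrow> (AE z in unit_lborel \<Otimes>\<^sub>M unit_lborel. f z = 0)"
proof -
  note P = prob_space_unit_lborel
  let ?H = "hom_integral unit_lborel V D (\<lambda>_ z. ennreal \<bar>f z\<bar>)"
  obtain u v where d0: "d0 = (u, v)" "(u, v) \<in> D" "u \<in> V" "v \<in> V" "u \<noteq> v"
    using D loopless by (cases d0) auto
  have finD: "finite D"
    using D V by (meson finite_SigmaI finite_subset)
  have "D \<noteq> {}"
    using D by auto
  then have n: "card D > 0"
    using finD by (simp add: card_gt_0_iff)
  have "borel_norm V D f = 0 \<longleftrightarrow> borel_norm V D f \<le> 0"
    by (simp add: borel_norm_def antisym_conv powr_ge_zero)
  also have "\<dots> \<longleftrightarrow> ?H = 0"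
    using borel_norm_le_iff[where g=f and C=C and x=0, OF D(1) finD \<open>D \<noteq> {}\<close> f(2)]
    by (simp add: zero_power[OF n])
  also have "\<dots> \<longleftrightarrow> (AE z in unit_lborel \<Otimes>\<^sub>M unit_lborel. f z = 0)"
  proof
    assume H: "?H = 0"
    define K where "K = (\<integral>\<^sup>+z. ennreal \<bar>f z\<bar> \<partial>(unit_lborel \<Otimes>\<^sub>M unit_lborel))"
    \<comment> \<open>Placing \<open>t * f\<close> on a single edge and \<open>1\<close> elsewhere gives \<open>t * K\<close>, bounded in \<open>t\<close> because the norm of \<open>t * f\<close> vanishes.\<close>
    have le_1: "ennreal t * K \<le> 1" if t: "0 < t" for t
    proof -
      have m: "(\<lambda>z. ennreal t * ennreal \<bar>f z\<bar>) \<in> borel_measurable (unit_lborel \<Otimes>\<^sub>M unit_lborel)"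
        using f(1) by measurable
      have "ennreal t * K = (\<integral>\<^sup>+z. ennreal t * ennreal \<bar>f z\<bar> \<partial>(unit_lborel \<Otimes>\<^sub>M unit_lborel))"
        unfolding K_def using f(1) by (subst nn_integral_cmult) auto
      also have "\<dots> = hom_integral unit_lborel V D
          (\<lambda>d. if d \<in> {(u, v)} then (\<lambda>z. ennreal t * ennreal \<bar>f z\<bar>) else (\<lambda>_. 1))"
        by (rule hom_integral_single_edge[OF P V finD d0(2-5) m, symmetric])
      also have "\<dots> \<le> max (hom_integral unit_lborel V D (\<lambda>_ z. ennreal t * ennreal \<bar>f z\<bar>))
          (hom_integral unit_lborel V D (\<lambda>_ _. 1))"
      \<comment> \<open>The bound has to dominate both the scaled kernel and the constant 1.\<close>
      proof (rule hom_integral_two_functions_le[OF P V D(1) m, where C="ennreal (max (t * C) 1)" and q=q and ?d0.0=d0])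
        show "ennreal t * ennreal \<bar>f z\<bar> \<le> ennreal (max (t * C) 1)" for z
          using f(2)[of z] t
          by (auto simp: ennreal_mult[symmetric] intro!: ennreal_leI max.coboundedI1)
        show "1 \<le> ennreal (max (t * C) 1)"
          by (subst ennreal_1[symmetric], rule ennreal_leI) simp
      qed (use q in auto)
      also have "hom_integral unit_lborel V D (\<lambda>_ z. ennreal t * ennreal \<bar>f z\<bar>) = 0"
        using hom_integral_cmult[OF D(1), of "\<lambda>_ z. ennreal \<bar>f z\<bar>" unit_lborel "\<lambda>_. ennreal t"] f(1) H
        by simp
      finally show ?thesis
        by (simp add: hom_integral_const[OF P])
    qed
    have "K \<le> ennreal 1"
      using le_1[of 1] by simp
    then obtain k where k: "K = ennreal k" "0 \<le> k"
      by (cases K) (auto simp: top_unique)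
    have "k = 0"
    proof (rule ccontr)
      assume "k \<noteq> 0"
      \<comment> \<open>The choice \<open>t = 2 / k\<close> makes the left side of
        \<open>le_1\<close> equal to 2.\<close>
      then have "ennreal (2 / k) * ennreal k = ennreal 2"
        using k(2) by (subst ennreal_mult[symmetric]) auto
      then show False
        using le_1[of "2 / k"] k \<open>k \<noteq> 0\<close> by simp
    qed
    then have "AE z in unit_lborel \<Otimes>\<^sub>M unit_lborel. ennreal \<bar>f z\<bar> = 0"
      using k(1) f(1) by (subst nn_integral_0_iff_AE[symmetric]) (auto simp: K_def)
    then show "AE z in unit_lborel \<Otimes>\<^sub>M unit_lborel. f z = 0"
      by eventually_elim simp
  next
    assume "AE z in unit_lborel \<Otimes>\<^sub>M unit_lborel. f z = 0"
    from AE_PiM_pair[OF P V d0(3-5) this]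
    have "AE x in Pi\<^sub>M V (\<lambda>_. unit_lborel). (\<Prod>d\<in>D. ennreal \<bar>f (x (fst d), x (snd d))\<bar>) = 0"
    proof eventually_elim
      case (elim x)
      then show ?case
        using finD d0(2) by (intro prod_zero bexI[of _ "(u, v)"]) auto
    qed
    then have "?H = (\<integral>\<^sup>+x. 0 \<partial>Pi\<^sub>M V (\<lambda>_. unit_lborel))"
      unfolding hom_integral_def by (rule nn_integral_cong_AE)
    then show "?H = 0" by simp
  qed
  finally show ?thesis .
qed

theorem theorem3p3:
  fixes V :: "'a set" and E :: "'a set set"
    and L R :: "('a \<Rightarrow> 'a) \<Rightarrow> 'a set"
  assumes "simple_graph V E"
    and "connected_graph V E"
    and "side_choice V E L R"
    and "edge_transitive_under E (cut_involution_group V E)"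
    and "\<exists>J N. percolating_sequence V E L R J N"
  shows "weakly_norming V E"
proof -
  obtain J N where "percolating_sequence V E L R J N"
    using assms(5) by blast
  then obtain e0 q where e0: "e0 \<in> E" and q': "\<forall>e\<in>E. q ` e = e0"
    and fold': "\<forall>A B. bipartition V E A B \<longrightarrow> q \<in> fold_monoid V (edge_pairs E A B)"
    by (rule percolating_sequence_fold[OF assms(2)])
  note q = bspec[OF q']
  have V: "finite V"
    using assms(1) by (simp add: simple_graph_def)
  \<comment> \<open>Here \<open>e0\<close> and \<open>q\<close> are fixed before the bipartition;
    only the ordered pair \<open>d0\<close> depends on \<open>A\<close> and
    \<open>B\<close>.\<close>
  have "norm_on_bounded_measurable (r_norm V E A B)" if bip: "bipartition V E A B" for A B
  proof -
    let ?D = "edge_pairs E A B"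
    have fold: "q \<in> fold_monoid V ?D"
      using fold' bip by blast
    obtain d0 where d0: "d0 \<in> ?D" and const': "\<forall>d\<in>?D. map_prod q q d = d0"
      by (rule fold_collapse_edge_pairs[OF bip e0 q fold])
    note const = bspec[OF const']
    have D: "?D \<subseteq> V \<times> V" "?D \<noteq> {}" and loopless: "\<And>u v. (u, v) \<in> ?D \<Longrightarrow> u \<noteq> v"
      using bip d0 by (auto simp: edge_pairs_def bipartition_def)
    have finD: "finite ?D"
      using D V by (meson finite_SigmaI finite_subset)
    note r_norm = r_norm_eq_borel_norm[OF V bip]
    note rep = bounded_measurable_borel_representative
    show ?thesis
      unfolding norm_on_bounded_measurable_def
    proof (intro conjI ballI allI)
      fix f assume "f \<in> bounded_measurable"
      show "0 \<le> r_norm V E A B f"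
        by (simp add: r_norm_def)
    next
      fix f assume "f \<in> bounded_measurable"
      then obtain f' C where f': "f' \<in> borel_measurable (unit_lborel \<Otimes>\<^sub>M unit_lborel)" "\<forall>z. \<bar>f' z\<bar> \<le> C"
        "AE z in unit_lborel \<Otimes>\<^sub>M unit_lborel. f z = f' z"
        by (rule rep)
      have "(AE z in unit_lborel \<Otimes>\<^sub>M unit_lborel. f' z = 0) \<longleftrightarrow> (AE z in unit_lborel \<Otimes>\<^sub>M unit_lborel. f z = 0)"
      proof
        assume "AE z in unit_lborel \<Otimes>\<^sub>M unit_lborel. f' z = 0"
        with f'(3) show "AE z in unit_lborel \<Otimes>\<^sub>M unit_lborel. f z = 0"
          by eventually_elim simp
      next
        assume "AE z in unit_lborel \<Otimes>\<^sub>M unit_lborel. f z = 0"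
        with f'(3) show "AE z in unit_lborel \<Otimes>\<^sub>M unit_lborel. f' z = 0"
          by eventually_elim simp
      qed
      then show "r_norm V E A B f = 0 \<longleftrightarrow> (AE z in lebesgue_on ({0..1} \<times> {0..1}). f z = 0)"
        using borel_norm_eq_0_iff[OF V D(1) d0 loopless fold const f'(1) spec[OF f'(2)]] r_norm[OF f'(1,3)]
        by (simp add: AE_unit_square_iff)
    next
      fix c f assume "f \<in> bounded_measurable"
      then obtain f' C where f': "f' \<in> borel_measurable (unit_lborel \<Otimes>\<^sub>M unit_lborel)" "\<forall>z. \<bar>f' z\<bar> \<le> C"
        "AE z in unit_lborel \<Otimes>\<^sub>M unit_lborel. f z = f' z"
        by (rule rep)
      have "r_norm V E A B (\<lambda>z. c * f z) = borel_norm V ?D (\<lambda>z. c * f' z)"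
      proof (rule r_norm)
        show "(\<lambda>z. c * f' z) \<in> borel_measurable (unit_lborel \<Otimes>\<^sub>M unit_lborel)"
          using f'(1) by measurable
        show "AE z in unit_lborel \<Otimes>\<^sub>M unit_lborel. c * f z = c * f' z"
          using f'(3) by eventually_elim simp
      qed
      then show "r_norm V E A B (\<lambda>z. c * f z) = \<bar>c\<bar> * r_norm V E A B f"
        by (simp only: r_norm[OF f'(1,3)] borel_norm_cmult[OF D(1) finD D(2) f'(1)])
    next
      fix f g assume "f \<in> bounded_measurable" "g \<in> bounded_measurable"
      obtain f' Cf where f': "f' \<in> borel_measurable (unit_lborel \<Otimes>\<^sub>M unit_lborel)" "\<forall>z. \<bar>f' z\<bar> \<le> Cf"
        "AE z in unit_lborel \<Otimes>\<^sub>M unit_lborel. f z = f' z"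
        using \<open>f \<in> bounded_measurable\<close> by (rule rep)
      obtain g' Cg where g': "g' \<in> borel_measurable (unit_lborel \<Otimes>\<^sub>M unit_lborel)" "\<forall>z. \<bar>g' z\<bar> \<le> Cg"
        "AE z in unit_lborel \<Otimes>\<^sub>M unit_lborel. g z = g' z"
        using \<open>g \<in> bounded_measurable\<close> by (rule rep)
      have "r_norm V E A B (\<lambda>z. f z + g z) = borel_norm V ?D (\<lambda>z. f' z + g' z)"
      proof (rule r_norm)
        show "(\<lambda>z. f' z + g' z) \<in> borel_measurable (unit_lborel \<Otimes>\<^sub>M unit_lborel)"
          using f'(1) g'(1) by measurable
        show "AE z in unit_lborel \<Otimes>\<^sub>M unit_lborel. f z + g z = f' z + g' z"
          using f'(3) g'(3) by eventually_elim simp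
      qed
      then show "r_norm V E A B (\<lambda>z. f z + g z) \<le> r_norm V E A B f + r_norm V E A B g"
        using borel_norm_triangle[OF V D fold const f'(1) spec[OF f'(2)] g'(1) spec[OF g'(2)]]
        by (simp only: r_norm[OF f'(1,3)] r_norm[OF g'(1,3)])
    qed
  qed
  \<comment> \<open>The colouring by \<open>q\<close> supplies a bipartition, so the universal
    statement just proved is not vacuous.\<close>
  then show ?thesis
    using bipartition_of_collapse[OF assms(1) e0 q] unfolding weakly_norming_def by blast
qed

end
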